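(* Let $V=(\alpha,\beta)\in E(L)$ with $V\dotplus(V^{(1)})^\vee=\xi$, and let $\kappa,\lambda_1,\lambda_2\in L$ with $\lambda_1\neq0$. The system of four conditions $$\text{(A1)}\ -\chi_1^q=\lambda_1^q\lambda_2+\gamma_1^q+\gamma_1,\qquad \text{(A2)}\ \chi_2^q=(\lambda_1^q\lambda_2+\gamma_1^q)\gamma_1-\lambda_1^{q+1}\gamma_2,$$ $$\text{(B1)}\ -\mathbf u\chi_1^q=\lambda_1^{q+1}+\mathbf u(\lambda_1^q\lambda_2+\gamma_1^q)+\mathbf v,\qquad \text{(B2)}\ \mathbf u\chi_2^q=(\lambda_1^q\lambda_2+\gamma_1^q)\mathbf v-\lambda_1^{q+1}\alpha$$ is equivalent to the system of two conditions $$\text{(C1)}\ \lambda_1^{q+1}=\mathbf u\gamma_1-\mathbf v,\qquad \text{(C2)}\ \lambda_1^q\lambda_2=-\chi_1^q-\gamma_1^q-\gamma_1 .$$ In other words, (C1) and (C2) are necessary and sufficient for the stability of the $\tau$-action, i.e. for $\tau M\subseteq M$. Moreover, when (C1) and (C2) hold, $$T_1=-h^{(1)}C_2^{(1)}=-C_1'^{(1)},\qquad T_2=\frac{T_1}{\alpha-x}(\Upsilon_2+\mathbf w\Upsilon_1)=\frac{C_1'^{(1)}}{x-\alpha}(\Upsilon_2+\mathbf w\Upsilon_1).$$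
   Context: Let $q$ be a prime power and $E: y^2+a_1xy+a_3y=x^3+a_2x^2+a_4x+a_6$ ($a_i\in\mathbb F_q$) an elliptic curve with point at infinity $\infty$; $\mathbf A=\mathbb F_q[x,y]$. Let $\mathbb K=\mathbb F_q(\theta,\eta)$ be an isomorphic copy of $\mathbb F_q(x,y)$ via $x\mapsto\theta,\ y\mapsto\eta$; $L\supseteq\mathbb K$ algebraically closed; $\xi=(\theta,\eta)$; $\mathbf A_L=L\otimes_{\mathbb F_q}\mathbf A$; $\mathbf K_L$ its fraction field. $\dotplus$ is the group law, $P^\vee$ the inverse of $P$ (so $(a,b)^\vee=(a,b^\vee)$, $b^\vee=-b-a_1a-a_3$), $(a,b)^{(1)}=(a^q,b^q)$; for $g\in\mathbf K_L$, $g^{(1)}$ is obtained by raising coefficients in $L$ to the $q$-th power and fixing $x,y$. $V^{-1}\mathbf A_L=\bigcup_{k\ge0}\mathcal L(V+k\infty)$. Let $m=\frac{\beta^q-\beta^\vee}{\alpha^q-\alpha}$ (slope of the line through $\xi,V^{(1)},V^\vee$) and $\gamma_1=(\kappa^q+m+a_1)(m-\kappa)-\theta$, $\gamma_2=-\kappa^q-m-a_1$, $\chi_1=\kappa^2+a_1\kappa-a_2-\alpha$, $\chi_2=a_4-2\kappa\beta^\vee+\kappa^2\alpha-a_1\beta^\vee-a_3\kappa+a_2\alpha+\alpha^2$, $\mathbf u=\kappa^q-\kappa$, $\mathbf v=(\beta^\vee)^q-\beta^\vee-\kappa^q\alpha^q+\kappa\alpha$, $\mathbf w=\mathbf u\gamma_2+\alpha^q-\alpha$,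 $h=\frac{x-\alpha}{y-\beta^\vee-\kappa(x-\alpha)}$, $C_2=x^2-\chi_1x+\chi_2$, $C_1'=hC_2=y+(\kappa+a_1)(x-\alpha)-\beta$. $$\Upsilon_1=\frac{x-\alpha^q}{C_1'^{(1)}}-\frac{\alpha-\alpha^q}{C_1'^{(1)}(\alpha,\beta^\vee)},\qquad \Upsilon_2=\frac{(x-\alpha^q)^2}{C_1'^{(1)}}-\frac{(\alpha-\alpha^q)^2}{C_1'^{(1)}(\alpha,\beta^\vee)},$$ where $C_1'^{(1)}(\alpha,\beta^\vee)=-\gamma_2(\alpha-\alpha^q)$. $$T_1=h^{(1)}\lambda_1^{q+1}\gamma_2-h^{(1)}(x+\lambda_1^q\lambda_2+\gamma_1^q)(x+\gamma_1),\qquad T_2=h^{(1)}\lambda_1^{q+1}+h^{(1)}(x+\lambda_1^q\lambda_2+\gamma_1^q)\tfrac1h .$$ $M=\mathbf A_LE_1\oplus V^{-1}\mathbf A_LE_2$ inside the $\mathbf K_L$-vector space with basis $E_1,E_2$, on which $\tau$ acts additively with $\tau(gm)=g^{(1)}\tau(m)$ and $\tau E_1=\frac1{\lambda_1}\big(-(x+\gamma_1)E_1+\frac1hE_2\big)$, $\tau E_2=\frac1{\lambda_1}(T_1E_1+T_2E_2)$. (In the paper $M=M_\phi$ is the Anderson motive of a sign-normalized rank-two Drinfeld module written in this basis.)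
   Formalization: The formula for T_2 is asserted only when γ_2 ≠ 0: Υ_1 and Υ_2 divide by C_1'^{(1)}(α,β^∨) = -γ_2(α-α^q), which vanishes for κ^q = -m-a_1, a case compatible with (C1) and (C2). All other claims hold without this condition. *)

theory Defs
  imports
    "HOL-Computational_Algebra.Computational_Algebra"
    "HOL-Library.Product_Plus"
begin

section \<open>Weierstrass curves and their group law\<close>

record 'a weierstrass =
  a1 :: 'a
  a2 :: 'a
  a3 :: 'a
  a4 :: 'a
  a6 :: 'a

definition on_curve :: "'a::field weierstrass \<Rightarrow> 'a \<Rightarrow> 'a \<Rightarrow> bool" where
  "on_curve E a b \<longleftrightarrow>
     b ^ 2 + a1 E * a * b + a3 E * b = a ^ 3 + a2 E * a ^ 2 + a4 E * a + a6 E"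

text \<open>Nonsingularity is tested at the affine points over the base type only (both partial
  derivatives vanish at no point of the curve), so it means smoothness when the base type is
  algebraically closed. The point at infinity of a Weierstrass curve is always smooth.\<close>

definition nonsingular :: "'a::field weierstrass \<Rightarrow> bool" where
  "nonsingular E \<longleftrightarrow>
     \<not> (\<exists>a b. on_curve E a b \<and>
          a1 E * b - (3 * a ^ 2 + 2 * a2 E * a + a4 E) = 0 \<and>
          2 * b + a1 E * a + a3 E = 0)"

datatype 'a point = Infinity | Affine 'a 'a

definition curve_points :: "'a::field weierstrass \<Rightarrow> 'a point set" where
  "curve_points E = {Infinity} \<union> {Affine a b |a b. on_curve E a b}"

fun pneg :: "'a::field weierstrass \<Rightarrow> 'a point \<Rightarrow> 'a point" where
  "pneg E Infinity = Infinity"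
| "pneg E (Affine a b) = Affine a (- b - a1 E * a - a3 E)"

fun padd :: "'a::field weierstrass \<Rightarrow> 'a point \<Rightarrow> 'a point \<Rightarrow> 'a point" where
  "padd E Infinity Q = Q"
| "padd E (Affine a b) Infinity = Affine a b"
| "padd E (Affine a b) (Affine c d) =
     (if Affine c d = pneg E (Affine a b) then Infinity
      else
        let s = (if a = c
                 then (3 * a ^ 2 + 2 * a2 E * a + a4 E - a1 E * b) / (2 * b + a1 E * a + a3 E)
                 else (d - b) / (c - a));
            e = s ^ 2 + a1 E * s - a2 E - a - c
        in pneg E (Affine e (b + s * (e - a))))"

definition frob_point :: "nat \<Rightarrow> 'a::field point \<Rightarrow> 'a point" where
  "frob_point q P = map_point (\<lambda>c. c ^ q) P"

text \<open>If the characteristic is \<open>p\<close>, \<open>q\<close> is a power of \<open>p\<close>, and the ambient field is algebraically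
  closed, this is its unique subfield with \<open>q\<close> elements.\<close>

definition Fq :: "nat \<Rightarrow> 'a::field set" where
  "Fq q = {c. c ^ q = c}"

definition defined_over_Fq :: "nat \<Rightarrow> 'a::field weierstrass \<Rightarrow> bool" where
  "defined_over_Fq q E \<longleftrightarrow>
     a1 E \<in> Fq q \<and> a2 E \<in> Fq q \<and> a3 E \<in> Fq q \<and> a4 E \<in> Fq q \<and> a6 E \<in> Fq q"


section \<open>The coordinate ring and the function field\<close>

text \<open>\<open>'a poly poly\<close> is read as the ring of polynomials in \<open>X, Y\<close>, with \<open>Y\<close> the outer variable.
  A polynomial over \<open>'a\<close> is evaluated in another field through the embedding \<open>\<iota>\<close>.\<close>

definition eval2 :: "('a::field \<Rightarrow> 'k::field) \<Rightarrow> 'k \<Rightarrow> 'k \<Rightarrow> 'a poly poly \<Rightarrow> 'k" where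
  "eval2 \<iota> s t F = poly (map_poly (\<lambda>f. poly (map_poly \<iota> f) s) F) t"

definition wpoly :: "'a::field weierstrass \<Rightarrow> 'a poly poly" where
  "wpoly E = [: - [:a6 E, a4 E, a2 E, 1:], [:a3 E, a1 E:], 1 :]"

text \<open>Sending the coordinates \<open>X, Y\<close> to \<open>(\<theta>, \<eta>)\<close> identifies the coordinate ring over the field
  of \<open>q\<close> elements with its image, so that \<open>(\<theta>, \<eta>)\<close> generates an isomorphic copy of the function
  field. As \<open>wpoly E\<close> is monic in \<open>Y\<close> with coefficients in \<open>Fq q\<close>, divisibility by it means the same
  for polynomials over \<open>Fq q\<close> and over \<open>'a\<close>.\<close>

definition generic_point :: "nat \<Rightarrow> 'a::field weierstrass \<Rightarrow> 'a \<Rightarrow> 'a \<Rightarrow> bool" where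
  "generic_point q E \<theta> \<eta> \<longleftrightarrow>
     (\<forall>F. (\<forall>i j. coeff (coeff F i) j \<in> Fq q) \<longrightarrow>
          (eval2 (\<lambda>c. c) \<theta> \<eta> F = 0 \<longleftrightarrow> wpoly E dvd F))"

text \<open>An extension field of the base field \<open>'a\<close>, with embedding \<open>\<iota>\<close>, in which \<open>x, y\<close> generate a
  copy of the coordinate ring \<open>'a[X,Y]/(wpoly E)\<close>. The extension may be larger than the function
  field, which is the subset \<open>func_field\<close> of quotients of elements of \<open>coord_ring\<close>.\<close>

definition coordinates ::
  "'a::field weierstrass \<Rightarrow> ('a \<Rightarrow> 'k::field) \<Rightarrow> 'k \<Rightarrow> 'k \<Rightarrow> bool" where
  "coordinates E \<iota> x y \<longleftrightarrow>
     \<iota> 0 = 0 \<and> \<iota> 1 = 1 \<and> (\<forall>c d. \<iota> (c + d) = \<iota> c + \<iota> d) \<and> (\<forall>c d. \<iota> (c * d) = \<iota> c * \<iota> d) \<and>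
     (\<forall>F. eval2 \<iota> x y F = 0 \<longleftrightarrow> wpoly E dvd F)"

definition coord_ring :: "('a::field \<Rightarrow> 'k::field) \<Rightarrow> 'k \<Rightarrow> 'k \<Rightarrow> 'k set" where
  "coord_ring \<iota> x y = range (eval2 \<iota> x y)"

definition func_field :: "('a::field \<Rightarrow> 'k::field) \<Rightarrow> 'k \<Rightarrow> 'k \<Rightarrow> 'k set" where
  "func_field \<iota> x y = {f / g |f g. f \<in> coord_ring \<iota> x y \<and> g \<in> coord_ring \<iota> x y \<and> g \<noteq> 0}"

definition coeff_frob :: "nat \<Rightarrow> 'a::field poly poly \<Rightarrow> 'a poly poly" where
  "coeff_frob q F = map_poly (map_poly (\<lambda>c. c ^ q)) F"

text \<open>The twist \<open>g\<^sup>(\<^sup>1\<^sup>)\<close> of an element \<open>g\<close> of the function field.\<close>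

definition twist :: "nat \<Rightarrow> ('a::field \<Rightarrow> 'k::field) \<Rightarrow> 'k \<Rightarrow> 'k \<Rightarrow> 'k \<Rightarrow> 'k" where
  "twist q \<iota> x y g =
     (THE h. \<exists>F G. eval2 \<iota> x y G \<noteq> 0 \<and> g = eval2 \<iota> x y F / eval2 \<iota> x y G \<and>
                   h = eval2 \<iota> x y (coeff_frob q F) / eval2 \<iota> x y (coeff_frob q G))"


section \<open>Local rings, orders of vanishing and Riemann--Roch spaces\<close>

definition chart_local_ring ::
  "('a::field \<Rightarrow> 'k::field) \<Rightarrow> 'k \<Rightarrow> 'k \<Rightarrow> 'a \<Rightarrow> 'a \<Rightarrow> 'k set" where
  "chart_local_ring \<iota> s t a b =
     {eval2 \<iota> s t F / eval2 \<iota> s t G |F G. eval2 (\<lambda>c. c) a b G \<noteq> 0}"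

text \<open>At infinity, i.e. at \<open>[0:1:0]\<close>, the chart \<open>Y = 1\<close> with coordinates \<open>X/Y\<close>, \<open>Z/Y\<close> is used.\<close>

fun local_ring :: "('a::field \<Rightarrow> 'k::field) \<Rightarrow> 'k \<Rightarrow> 'k \<Rightarrow> 'a point \<Rightarrow> 'k set" where
  "local_ring \<iota> x y (Affine a b) = chart_local_ring \<iota> x y a b"
| "local_ring \<iota> x y Infinity = chart_local_ring \<iota> (x / y) (1 / y) 0 0"

definition ring_units :: "'k::field set \<Rightarrow> 'k set" where
  "ring_units R = {f \<in> R. f \<noteq> 0 \<and> inverse f \<in> R}"

definition max_ideal :: "'k::field set \<Rightarrow> 'k set" where
  "max_ideal R = R - ring_units R"

definition uniformizer :: "'k::field set \<Rightarrow> 'k \<Rightarrow> bool" where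
  "uniformizer R t \<longleftrightarrow> t \<noteq> 0 \<and> max_ideal R = {t * f |f. f \<in> R}"

text \<open>Only meaningful for nonzero \<open>f\<close> in the function field.\<close>

definition ord_at :: "('a::field \<Rightarrow> 'k::field) \<Rightarrow> 'k \<Rightarrow> 'k \<Rightarrow> 'a point \<Rightarrow> 'k \<Rightarrow> int" where
  "ord_at \<iota> x y P f =
     (THE n. \<exists>t u. uniformizer (local_ring \<iota> x y P) t \<and> u \<in> ring_units (local_ring \<iota> x y P) \<and>
                   f = u * t powi n)"

text \<open>The value at \<open>P\<close> of a function regular at \<open>P\<close>.\<close>

definition value_at :: "('a::field \<Rightarrow> 'k::field) \<Rightarrow> 'k \<Rightarrow> 'k \<Rightarrow> 'a point \<Rightarrow> 'k \<Rightarrow> 'a" where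
  "value_at \<iota> x y P f = (THE c. f - \<iota> c \<in> max_ideal (local_ring \<iota> x y P))"

definition riemann_roch ::
  "'a::field weierstrass \<Rightarrow> ('a \<Rightarrow> 'k::field) \<Rightarrow> 'k \<Rightarrow> 'k \<Rightarrow> ('a point \<Rightarrow> int) \<Rightarrow> 'k set" where
  "riemann_roch E \<iota> x y D =
     {f \<in> func_field \<iota> x y. f = 0 \<or> (\<forall>P \<in> curve_points E. ord_at \<iota> x y P f + D P \<ge> 0)}"

definition point_divisor :: "'a point \<Rightarrow> 'a point \<Rightarrow> int" where
  "point_divisor V P = (if P = V then 1 else 0)"

text \<open>The fractional ideal \<open>V\<^sup>-\<^sup>1 A\<^sub>L\<close>.\<close>

definition inverse_ideal ::
  "'a::field weierstrass \<Rightarrow> ('a \<Rightarrow> 'k::field) \<Rightarrow> 'k \<Rightarrow> 'k \<Rightarrow> 'a point \<Rightarrow> 'k set" where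
  "inverse_ideal E \<iota> x y V =
     (\<Union>k::nat. riemann_roch E \<iota> x y
        (\<lambda>P. point_divisor V P + int k * point_divisor Infinity P))"


section \<open>The two-dimensional space and the tau-action\<close>

text \<open>A pair \<open>(f, g)\<close> stands for \<open>f E\<^sub>1 + g E\<^sub>2\<close>.\<close>

definition scale :: "'k::field \<Rightarrow> 'k \<times> 'k \<Rightarrow> 'k \<times> 'k" where
  "scale g v = (g * fst v, g * snd v)"

definition twist_semilinear ::
  "nat \<Rightarrow> ('a::field \<Rightarrow> 'k::field) \<Rightarrow> 'k \<Rightarrow> 'k \<Rightarrow> ('k \<times> 'k \<Rightarrow> 'k \<times> 'k) \<Rightarrow> bool" where
  "twist_semilinear q \<iota> x y \<tau> \<longleftrightarrow>
     (let K = func_field \<iota> x y in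
      (\<forall>v \<in> K \<times> K. \<forall>w \<in> K \<times> K. \<tau> (v + w) = \<tau> v + \<tau> w) \<and>
      (\<forall>g \<in> K. \<forall>v \<in> K \<times> K. \<tau> (scale g v) = scale (twist q \<iota> x y g) (\<tau> v)))"

end

theory Submission
  imports Defs
begin

text \<open>Write \<open>A = L[x] \<oplus> L[x] y\<close> for the coordinate ring and \<open>V'\<close> for the inverse of \<open>V\<close>. Let \<open>\<delta> =
\<lambda>\<^sub>1\<^sup>q \<lambda>\<^sub>2 + \<gamma>\<^sub>1\<^sup>q\<close> and let \<open>C\<^sub>1\<close>, \<open>C\<^sub>2\<close> be the twists of \<open>C\<^sub>1'\<close>, \<open>C\<^sub>2\<close>. The line through \<open>V'\<close> of slope
\<open>\<kappa>\<close> has norm \<open>-(x - \<alpha>) (x\<^sup>2 - \<chi>\<^sub>1 x + \<chi>\<^sub>2)\<close>, the factor \<open>x - \<alpha>\<close> being due to \<open>V'\<close>;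
hence the twist of \<open>h\<close> is \<open>C\<^sub>1 / C\<^sub>2\<close>, where \<open>C\<^sub>1\<close> has \<open>y\<close>-coefficient \<open>1\<close> and \<open>C\<^sub>2 \<in> L[x]\<close> is a monic
quadratic polynomial.

This turns membership in \<open>A\<close> into divisibility in \<open>L[x]\<close>: \<open>C\<^sub>1 Q / C\<^sub>2\<close> lies in \<open>A\<close> iff \<open>C\<^sub>2\<close> divides \<open>Q\<close>
(\<open>fraction_mem_ring_iff\<close>). Both \<open>T\<^sub>1\<close> and \<open>(x - \<alpha>) T\<^sub>2\<close> are, up to elements of \<open>A\<close>, of the form
\<open>C\<^sub>1 Q / C\<^sub>2\<close> with \<open>Q\<close> of degree at most two, so that divisibility is a comparison of coefficients. It
gives (A1), (A2) for \<open>T\<^sub>1\<close> (\<open>T1_mem_iff\<close>) and (B1), (B2) for \<open>(x - \<alpha>) T\<^sub>2\<close> (\<open>T2_mem_iff\<close>). Stability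
of \<open>M\<close>, applied to \<open>E\<^sub>2\<close>, forces both memberships, hence the four conditions.

The four conditions collapse to two because of two identities that come from the line through \<open>V'\<close>,
\<open>V\<^sup>(\<^sup>1\<^sup>)\<close> and \<open>\<xi>\<close> (\<open>coefficient_identities\<close>): the sum of its three abscissae gives
\<open>-\<chi>\<^sub>1\<^sup>q - \<gamma>\<^sub>1 = u \<gamma>\<^sub>2 - \<alpha>\<close>, and their second symmetric function gives \<open>\<chi>\<^sub>2\<^sup>q = v \<gamma>\<^sub>2 - \<alpha> \<gamma>\<^sub>1\<close>.
The line exists because \<open>\<alpha>\<^sup>q \<noteq> \<alpha>\<close>: otherwise \<open>V\<^sup>(\<^sup>1\<^sup>)\<close> would be \<open>V\<close> or \<open>V'\<close>, and \<open>\<xi>\<close> would be infinite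
or defined over the field with \<open>q\<^sup>2\<close> elements (\<open>frob_moves_point\<close>).

Conversely, under (C1) and (C2) one finds \<open>T\<^sub>1 = -C\<^sub>1\<close> and \<open>(x - \<alpha>) T\<^sub>2 = (x + \<delta>) (x - \<alpha>\<^sup>q) + u C\<^sub>1\<close>, an
element of the ideal of \<open>V\<^sup>(\<^sup>1\<^sup>)\<close> that vanishes at \<open>V'\<close> by the first identity. The formula for \<open>T\<^sub>2\<close> in terms of
\<open>\<Upsilon>\<^sub>1\<close>, \<open>\<Upsilon>\<^sub>2\<close> is a rewriting of this. For stability, the inverse ideal is made algebraic
(\<open>inverse_ideal_iff\<close>): \<open>f\<close> lies in it iff \<open>(x - \<alpha>) f\<close> and \<open>(y - \<beta>) f\<close> lie in \<open>A\<close>. Then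
multiplication by the generators of the ideals of \<open>V\<close> and \<open>V\<^sup>(\<^sup>1\<^sup>)\<close> suffices (\<open>stable_E2\<close>).

The equivalence \<open>inverse_ideal_iff\<close> rests on the geometry of the smooth curve: every local ring is a
discrete valuation ring in which \<open>x - a\<close> or \<open>y - b\<close> is a uniformizer, so that the order of vanishing
is well defined (\<open>ord_at_ge_iff\<close>), and a function without affine poles lies in \<open>A\<close>
(\<open>func_field_regular_mem_ring\<close>). At infinity the inverse ideal allows poles of every order, so only the affine
points matter.\<close>

section \<open>Ring homomorphisms and evaluation of polynomials\<close>

locale ring_map =
  fixes \<phi> :: "'r::comm_ring_1 \<Rightarrow> 's::comm_ring_1"
  assumes map_zero [simp]: "\<phi> 0 = 0"
    and map_one [simp]: "\<phi> 1 = 1"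
    and map_add [simp]: "\<phi> (a + b) = \<phi> a + \<phi> b"
    and map_mult [simp]: "\<phi> (a * b) = \<phi> a * \<phi> b"
begin

lemma map_minus [simp]: "\<phi> (- a) = - \<phi> a"
  by (metis add.right_inverse add_eq_0_iff map_add map_zero)

lemma map_diff [simp]: "\<phi> (a - b) = \<phi> a - \<phi> b"
  by (simp only: diff_conv_add_uminus map_add map_minus)

lemma map_power [simp]: "\<phi> (a ^ k) = \<phi> a ^ k"
  by (induction k) auto

lemma map_of_nat: "\<phi> (of_nat k) = of_nat k"
  by (induction k) auto

lemma map_numeral [simp]: "\<phi> (numeral k) = numeral k"
  by (metis map_of_nat of_nat_numeral)

lemma map_sum: "\<phi> (sum f S) = (\<Sum>i\<in>S. \<phi> (f i))"
  by (induction S rule: infinite_finite_induct) auto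

text \<open>Used for two layers: applied to an embedding of the base field it evaluates in \<open>x\<close>, and applied
to the resulting map it evaluates in \<open>y\<close>.\<close>

lemma ring_map_eval: "ring_map (\<lambda>f. poly (map_poly \<phi> f) s)"
proof -
  define e where "e = (\<lambda>f. poly (map_poly \<phi> f) s)"
  have e_pCons: "e (pCons c f) = \<phi> c + s * e f" for c f
    by (simp add: e_def map_poly_pCons)
  have e_0: "e 0 = 0"
    by (simp add: e_def)
  have add: "e (f + g) = e f + e g" for f g
    by (induction f g rule: poly_induct2) (simp_all add: e_0 e_pCons algebra_simps)
  have smult: "e (smult c f) = \<phi> c * e f" for c f
    by (induction f) (simp_all add: e_0 e_pCons algebra_simps)
  have "e (f * g) = e f * e g" for f g
    by (induction f) (simp_all add: e_0 e_pCons add smult algebra_simps)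
  then show ?thesis
    unfolding ring_map_def e_def[symmetric] using add e_0 e_pCons[of 1 0]
    by (simp flip: one_pCons)
qed

lemma ring_map_coeffs: "ring_map (map_poly \<phi>)"
  by unfold_locales
    (auto intro!: poly_eqI simp: coeff_map_poly coeff_mult map_sum)

end

lemma ring_map_eval2:
  assumes "ring_map \<iota>"
  shows "ring_map (eval2 \<iota> s t)"
proof -
  interpret \<iota>: ring_map \<iota> by fact
  interpret e: ring_map "\<lambda>f. poly (map_poly \<iota> f) s" by (rule \<iota>.ring_map_eval)
  show ?thesis
    unfolding eval2_def by (rule e.ring_map_eval)
qed

lemma eval2_pCons:
  assumes "ring_map \<iota>"
  shows "eval2 \<iota> s t (pCons f F) = poly (map_poly \<iota> f) s + t * eval2 \<iota> s t F"
proof -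
  interpret \<iota>: ring_map \<iota> by fact
  show ?thesis
    by (simp add: eval2_def map_poly_pCons)
qed

lemma ring_map_id: "ring_map (\<lambda>c. c)"
  by unfold_locales auto

interpretation at_point: ring_map "eval2 (\<lambda>c. c) a b" for a b :: "'a::field"
  by (intro ring_map_eval2 ring_map_id)

lemma at_point_pCons [simp]:
  "eval2 (\<lambda>c. c) a b (pCons f F) = poly f a + b * eval2 (\<lambda>c. c) a b F"
  by (simp add: eval2_pCons ring_map_id)

lemma at_point_wpoly:
  "eval2 (\<lambda>c. c) a b (wpoly E) = 0 \<longleftrightarrow> on_curve E a b"
  by (simp add: wpoly_def on_curve_def algebra_simps power2_eq_square power3_eq_cube) 

section \<open>The coordinate ring as a free module over the polynomials in x\<close>

locale curve_coordinates =
  fixes E :: "'a::field weierstrass" and \<iota> :: "'a \<Rightarrow> 'k::field" and x y :: 'k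
  assumes coords: "coordinates E \<iota> x y"
begin

sublocale \<iota>: ring_map \<iota>
  using coords by (simp add: coordinates_def ring_map_def)

abbreviation of_x :: "'a poly \<Rightarrow> 'k" where
  "of_x f \<equiv> poly (map_poly \<iota> f) x"

abbreviation ev :: "'a poly poly \<Rightarrow> 'k" where
  "ev \<equiv> eval2 \<iota> x y"

abbreviation ev_at :: "'a \<Rightarrow> 'a \<Rightarrow> 'a poly poly \<Rightarrow> 'a" where
  "ev_at \<equiv> eval2 (\<lambda>c. c)"

abbreviation A :: "'k set" where
  "A \<equiv> coord_ring \<iota> x y"

sublocale of_x: ring_map of_x
  by (rule \<iota>.ring_map_eval)

sublocale ev: ring_map ev
  by (rule ring_map_eval2) unfold_locales

lemma ev_pCons [simp]: "ev (pCons f F) = of_x f + y * ev F"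
  by (simp add: eval2_pCons \<iota>.ring_map_axioms)

lemma of_x_pCons [simp]: "poly (map_poly \<iota> (pCons c f)) x = \<iota> c + x * of_x f"
  by (simp add: map_poly_pCons)

lemma of_x_smult [simp]: "poly (map_poly \<iota> (smult c f)) x = \<iota> c * of_x f"
  using of_x.map_mult[of "[:c:]" f] by simp

lemma ev_eq_0_iff: "ev F = 0 \<longleftrightarrow> wpoly E dvd F"
  using coords by (simp add: coordinates_def)

lemma \<iota>_eq_0_iff [simp]: "\<iota> c = 0 \<longleftrightarrow> c = 0"
  by (metis \<iota>.map_mult \<iota>.map_one \<iota>.map_zero mult_zero_left right_inverse zero_neq_one)

lemma \<iota>_eq_iff [simp]: "\<iota> c = \<iota> d \<longleftrightarrow> c = d"
  by (metis \<iota>.map_diff \<iota>_eq_0_iff eq_iff_diff_eq_0)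

lemma \<iota>_divide [simp]: "\<iota> (c / d) = \<iota> c / \<iota> d"
  by (metis \<iota>.map_mult \<iota>_eq_0_iff \<iota>.map_zero div_by_0 eq_divide_eq nonzero_mult_div_cancel_right times_divide_eq_left)

lemma equation:
  "y ^ 2 + \<iota> (a1 E) * x * y + \<iota> (a3 E) * y
     = x ^ 3 + \<iota> (a2 E) * x ^ 2 + \<iota> (a4 E) * x + \<iota> (a6 E)"
proof -
  have "ev (wpoly E) = 0"
    by (simp add: ev_eq_0_iff)
  then show ?thesis
    by (simp add: wpoly_def algebra_simps power2_eq_square power3_eq_cube)
qed

lemma ring_mem [simp, intro]:
  "ev F \<in> A" "x \<in> A" "y \<in> A" "\<iota> c \<in> A" "of_x f \<in> A" "0 \<in> A" "1 \<in> A"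
proof -
  show 1: "ev F \<in> A" for F
    by (simp add: coord_ring_def)
  show "x \<in> A" "y \<in> A" "\<iota> c \<in> A" "of_x f \<in> A" "0 \<in> A" "1 \<in> A"
    using 1[of "[:[:0, 1:]:]"] 1[of "[:0, 1:]"] 1[of "[:[:c:]:]"] 1[of "[:f:]"] 1[of 0] 1[of 1]
    by simp_all
qed

lemma ring_closed [intro]:
  assumes "f \<in> A" "g \<in> A"
  shows "f + g \<in> A" "f - g \<in> A" "f * g \<in> A"
proof -
  obtain F G where "f = ev F" "g = ev G"
    using assms by (auto simp: coord_ring_def)
  then show "f + g \<in> A" "f - g \<in> A" "f * g \<in> A"
    using ring_mem(1)[of "F + G"] ring_mem(1)[of "F - G"] ring_mem(1)[of "F * G"] by simp_all
qed

lemma ring_minus [intro]: "f \<in> A \<Longrightarrow> - f \<in> A"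
  using ring_closed(2)[of 0 f] by simp

lemma ring_power [intro]: "f \<in> A \<Longrightarrow> f ^ k \<in> A"
  by (induction k) auto

text \<open>The Weierstrass equation lowers powers of \<open>y\<close>, so \<open>1\<close> and \<open>y\<close> generate.\<close>

lemma basis_exists:
  assumes "r \<in> A"
  obtains f g where "r = of_x f + of_x g * y"
proof -
  have "\<exists>f g. ev F = of_x f + of_x g * y" for F
  proof (induction F)
    case 0
    show ?case by (rule exI[of _ 0], rule exI[of _ 0]) simp
  next
    case (pCons c F)
    then obtain f g where fg: "ev F = of_x f + of_x g * y"
      by blast
    define f' where "f' = c + g * [:a6 E, a4 E, a2 E, 1:]"
    define g' where "g' = f - g * [:a3 E, a1 E:]"
    have "ev (pCons c F) = of_x f' + of_x g' * y"
      using equation unfolding ev_pCons fg f'_def g'_def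
      by (simp add: power2_eq_square power3_eq_cube) algebra
    then show ?case by blast
  qed
  then show ?thesis
    using assms that by (auto simp: coord_ring_def)
qed

text \<open>A relation would be a polynomial of degree at most one in \<open>Y\<close> divisible by the Weierstrass
polynomial, which has degree two in \<open>Y\<close>.\<close>

lemma basis_unique_0:
  assumes "of_x f + of_x g * y = 0"
  shows "f = 0 \<and> g = 0"
proof -
  have "ev [:f, g:] = 0"
    using assms by (simp add: mult.commute)
  then have "wpoly E dvd [:f, g:]"
    by (simp only: ev_eq_0_iff)
  then have "[:f, g:] = 0"
    by (rule_tac ccontr) (auto dest: dvd_imp_degree_le simp: wpoly_def split: if_splits)
  then show ?thesis by simp
qed

lemma basis_unique:
  assumes "of_x f + of_x g * y = of_x f' + of_x g' * y"
  shows "f = f' \<and> g = g'"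
  using basis_unique_0[of "f - f'" "g - g'"] assms by (simp add: algebra_simps)

lemma of_x_eq_0_iff [simp]: "poly (map_poly \<iota> f) x = 0 \<longleftrightarrow> f = 0"
  using basis_unique_0[of f 0] by auto

lemma x_minus_nonzero [simp]: "x - \<iota> c \<noteq> 0" "x \<noteq> \<iota> c"
  using basis_unique_0[of "[:- c, 1:]" 0] by auto

lemma y_minus_nonzero [simp]: "y - \<iota> c \<noteq> 0"
  using basis_unique_0[of "[:- c:]" 1] by auto

lemma of_x_remainder:
  obtains g where "of_x f = \<iota> (poly f a) + (x - \<iota> a) * of_x g"
proof -
  have "[:- a, 1:] dvd f - [:poly f a:]"
    by (simp add: dvd_iff_poly_eq_0)
  then obtain g where "f - [:poly f a:] = [:- a, 1:] * g"
    by (elim dvdE)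
  then have "f = [:poly f a:] + [:- a, 1:] * g"
    by (simp add: algebra_simps)
  then have "of_x f = of_x ([:poly f a:] + [:- a, 1:] * g)"
    by simp
  then show ?thesis
    using that unfolding of_x.map_add of_x.map_mult by simp
qed

lemma on_curve_\<iota>:
  assumes "on_curve E a b"
  shows "\<iota> b ^ 2 + \<iota> (a1 E) * \<iota> a * \<iota> b + \<iota> (a3 E) * \<iota> b
     = \<iota> a ^ 3 + \<iota> (a2 E) * \<iota> a ^ 2 + \<iota> (a4 E) * \<iota> a + \<iota> (a6 E)"
  using arg_cong[OF assms[unfolded on_curve_def], of \<iota>] by simp

text \<open>The cofactor is the image of \<open>f\<close> under \<open>y \<mapsto> -y - a\<^sub>1 x - a\<^sub>3\<close>. Norms reduce questions about
denominators and orders of vanishing to polynomials in \<open>x\<close> alone.\<close>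

lemma norm_exists:
  assumes "f \<in> A" "f \<noteq> 0"
  obtains g N where "g \<in> A" "f * g = of_x N" "N \<noteq> 0"
proof -
  obtain f0 f1 where f: "f = of_x f0 + of_x f1 * y"
    using assms(1) by (rule basis_exists)
  define g where "g = of_x (f0 - f1 * [:a3 E, a1 E:]) + of_x (- f1) * y"
  define N where "N = f0 * f0 - f0 * f1 * [:a3 E, a1 E:] - f1 * f1 * [:a6 E, a4 E, a2 E, 1:]"
  have "f * g = of_x N"
    using equation unfolding f g_def N_def
    by (simp add: power2_eq_square power3_eq_cube) algebra
  moreover have "g \<noteq> 0"
  proof
    assume "g = 0"
    then have "f0 - f1 * [:a3 E, a1 E:] = 0 \<and> - f1 = 0"
      unfolding g_def by (rule basis_unique_0)
    then show False
      using assms(2) f by simp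
  qed
  moreover have "g \<in> A"
    unfolding g_def by (intro ring_closed ring_mem)
  ultimately show ?thesis
    using that assms(2) by (metis mult_eq_0_iff of_x.map_zero)
qed

section \<open>Local rings of the curve are discrete valuation rings\<close>

text \<open>Regularity and value at a point in one relation, so that the local ring, its units and its maximal
ideal are all described through the values that its elements take.\<close>

definition has_value :: "'a \<Rightarrow> 'a \<Rightarrow> 'k \<Rightarrow> 'a \<Rightarrow> bool" where
  "has_value a b r c \<longleftrightarrow>
     (\<exists>F G. ev_at a b G \<noteq> 0 \<and> r = ev F / ev G \<and> c = ev_at a b F / ev_at a b G)"

end

locale smooth_point = curve_coordinates E \<iota> x y
  for E :: "'a::field weierstrass" and \<iota> :: "'a \<Rightarrow> 'k::field" and x y :: 'k +
  fixes a b :: 'a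
  assumes on_curve: "on_curve E a b"
    and nonsingular: "nonsingular E"
begin

abbreviation R :: "'k set" where
  "R \<equiv> chart_local_ring \<iota> x y a b"

text \<open>Evaluation at a point of the curve factors through the coordinate ring.\<close>

lemma ev_at_cong:
  assumes "ev F = ev G"
  shows "ev_at a b F = ev_at a b G"
proof -
  have "ev (F - G) = 0"
    using assms by simp
  then obtain H where "F - G = wpoly E * H"
    unfolding ev_eq_0_iff by (elim dvdE)
  then have "ev_at a b (F - G) = 0"
    using on_curve by (metis at_point.map_mult at_point_wpoly mult_zero_left)
  then show ?thesis by simp
qed

lemma ev_nonzero: "ev_at a b G \<noteq> 0 \<Longrightarrow> ev G \<noteq> 0"
  using ev_at_cong[of G 0] by auto

lemma mem_R_iff: "r \<in> R \<longleftrightarrow> (\<exists>c. has_value a b r c)"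
  by (auto simp: chart_local_ring_def has_value_def)

lemma has_value_unique:
  assumes "has_value a b r c" "has_value a b r d"
  shows "c = d"
proof -
  obtain F G F' G' where FG:
    "ev_at a b G \<noteq> 0" "r = ev F / ev G" "c = ev_at a b F / ev_at a b G"
    "ev_at a b G' \<noteq> 0" "r = ev F' / ev G'" "d = ev_at a b F' / ev_at a b G'"
    using assms unfolding has_value_def by blast
  then have "ev (F * G') = ev (F' * G)"
    using ev_nonzero[of G] ev_nonzero[of G'] by (simp add: frac_eq_eq)
  from ev_at_cong[OF this] show ?thesis
    using FG by (simp add: frac_eq_eq)
qed

lemma has_value_ev: "has_value a b (ev F) (ev_at a b F)"
  unfolding has_value_def by (rule exI[of _ F], rule exI[of _ 1]) simp

lemma has_value_coord [intro]:
  "has_value a b x a" "has_value a b y b" "has_value a b (\<iota> c) c"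
  "has_value a b 0 0" "has_value a b 1 1" "has_value a b (of_x f) (poly f a)"
  using has_value_ev[of "[:[:0, 1:]:]"] has_value_ev[of "[:0, 1:]"] has_value_ev[of "[:[:c:]:]"]
    has_value_ev[of 0] has_value_ev[of 1] has_value_ev[of "[:f:]"] by simp_all

lemma has_value_closed [intro]:
  assumes "has_value a b r c" "has_value a b s d"
  shows "has_value a b (r + s) (c + d)" "has_value a b (r - s) (c - d)"
    "has_value a b (r * s) (c * d)"
proof -
  obtain F G F' G' where FG:
    "ev_at a b G \<noteq> 0" "r = ev F / ev G" "c = ev_at a b F / ev_at a b G"
    "ev_at a b G' \<noteq> 0" "s = ev F' / ev G'" "d = ev_at a b F' / ev_at a b G'"
    using assms unfolding has_value_def by blast
  then have nz: "ev G \<noteq> 0" "ev G' \<noteq> 0"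
    by (auto dest: ev_nonzero)
  have "has_value a b (ev H / ev (G * G')) (ev_at a b H / ev_at a b (G * G'))" for H
    unfolding has_value_def using FG by (intro exI[of _ H] exI[of _ "G * G'"]) auto
  from this[of "F * G' + F' * G"] this[of "F * G' - F' * G"] this[of "F * F'"]
  show "has_value a b (r + s) (c + d)" "has_value a b (r - s) (c - d)"
    "has_value a b (r * s) (c * d)"
    using FG nz by (simp_all add: add_frac_eq diff_frac_eq)
qed

lemma has_value_inverse:
  assumes "has_value a b r c" "c \<noteq> 0"
  shows "has_value a b (inverse r) (inverse c)"
  using assms unfolding has_value_def by (metis divide_eq_0_iff inverse_divide)

lemma R_mem [intro]: "f \<in> A \<Longrightarrow> f \<in> R"
  using has_value_ev by (auto simp: coord_ring_def mem_R_iff)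

lemma R_closed [intro]:
  assumes "r \<in> R" "s \<in> R"
  shows "r + s \<in> R" "r - s \<in> R" "r * s \<in> R"
  using assms has_value_closed unfolding mem_R_iff by blast+

lemma R_power [intro]: "r \<in> R \<Longrightarrow> r ^ k \<in> R"
  by (induction k) auto

lemma unit_iff: "r \<in> ring_units R \<longleftrightarrow> (\<exists>c. c \<noteq> 0 \<and> has_value a b r c)"
proof
  assume "r \<in> ring_units R"
  then obtain c d where cd: "r \<noteq> 0" "has_value a b r c" "has_value a b (inverse r) d"
    by (auto simp: ring_units_def mem_R_iff)
  then have "has_value a b 1 (c * d)"
    using has_value_closed(3)[OF cd(2,3)] by simp
  then have "c * d = 1"
    using has_value_unique has_value_coord(5) by blast
  then have "c \<noteq> 0"
    by auto
  then show "\<exists>c. c \<noteq> 0 \<and> has_value a b r c"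
    using cd by blast
next
  assume "\<exists>c. c \<noteq> 0 \<and> has_value a b r c"
  then show "r \<in> ring_units R"
    using has_value_inverse has_value_unique[OF _ has_value_coord(4)]
    by (auto simp: ring_units_def mem_R_iff)
qed

lemma max_ideal_iff: "r \<in> max_ideal R \<longleftrightarrow> has_value a b r 0"
  using has_value_unique unfolding max_ideal_def Diff_iff unit_iff mem_R_iff by metis

lemma unit_closed [intro]:
  assumes "r \<in> ring_units R"
  shows "inverse r \<in> ring_units R" "s \<in> ring_units R \<Longrightarrow> r * s \<in> ring_units R"
    "r ^ k \<in> ring_units R" "r powi i \<in> ring_units R" "r \<in> R" "r \<noteq> 0"
proof -
  have mult: "r * s \<in> ring_units R" if "r \<in> ring_units R" "s \<in> ring_units R" for r s
    using that has_value_closed(3) unfolding unit_iff by (metis mult_eq_0_iff)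
  have inv: "inverse r \<in> ring_units R" if "r \<in> ring_units R" for r
    using that has_value_inverse unfolding unit_iff by (metis nonzero_imp_inverse_nonzero)
  have one: "1 \<in> ring_units R"
    unfolding unit_iff using has_value_coord(5) by (intro exI[of _ 1]) auto
  have pow: "r ^ k \<in> ring_units R" if "r \<in> ring_units R" for r k
    by (induction k) (use one mult that in auto)
  show "r powi i \<in> ring_units R" "r \<in> R" "r \<noteq> 0" "inverse r \<in> ring_units R"
      "r ^ k \<in> ring_units R" "s \<in> ring_units R \<Longrightarrow> r * s \<in> ring_units R"
    using assms pow inv mult by (auto simp: power_int_def ring_units_def)
qed

lemma value_at_eq:
  assumes "has_value a b r c"
  shows "value_at \<iota> x y (Affine a b) r = c"
  unfolding value_at_def
proof (rule the_equality)
  show "r - \<iota> c \<in> max_ideal (local_ring \<iota> x y (Affine a b))"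
    using has_value_closed(2)[OF assms has_value_coord(3)[of c]] by (simp add: max_ideal_iff)
next
  fix d
  assume "r - \<iota> d \<in> max_ideal (local_ring \<iota> x y (Affine a b))"
  then have "has_value a b (r - \<iota> d + \<iota> d) (0 + d)"
    by (intro has_value_closed has_value_coord) (simp add: max_ideal_iff)
  then show "d = c"
    using assms has_value_unique by simp
qed

text \<open>Taylor expansion to first order: a polynomial differs from its value at \<open>(a, b)\<close> by a combination of
\<open>x - a\<close> and \<open>y - b\<close>.\<close>

lemma ideal_generators:
  assumes "has_value a b r 0"
  obtains s1 s2 where "s1 \<in> R" "s2 \<in> R" "r = (x - \<iota> a) * s1 + (y - \<iota> b) * s2"
proof -
  obtain F G where FG: "ev_at a b G \<noteq> 0" "r = ev F / ev G" "ev_at a b F = 0"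
    using assms unfolding has_value_def by force
  have linear: "\<exists>f1\<in>A. \<exists>f2\<in>A. ev F = \<iota> (ev_at a b F) + (x - \<iota> a) * f1 + (y - \<iota> b) * f2" for F
  proof (induction F)
    case (pCons f F)
    then obtain f1 f2 where f12: "f1 \<in> A" "f2 \<in> A"
      "ev F = \<iota> (ev_at a b F) + (x - \<iota> a) * f1 + (y - \<iota> b) * f2"
      by blast
    obtain g where fg: "of_x f = \<iota> (poly f a) + (x - \<iota> a) * of_x g"
      by (rule of_x_remainder)
    have "ev (pCons f F) = \<iota> (ev_at a b (pCons f F)) + (x - \<iota> a) * (of_x g + \<iota> b * f1)
        + (y - \<iota> b) * (ev F + \<iota> b * f2)"
      by (simp add: fg f12(3) algebra_simps)
    moreover have "of_x g + \<iota> b * f1 \<in> A" "ev F + \<iota> b * f2 \<in> A"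
      by (intro ring_closed ring_mem f12)+
    ultimately show ?case by blast
  next
    case 0
    show ?case by (intro bexI[of _ 0] ring_mem) simp
  qed
  obtain f1 f2 where f12: "f1 \<in> A" "f2 \<in> A"
      "ev F = (x - \<iota> a) * f1 + (y - \<iota> b) * f2"
    using linear[of F] unfolding FG(3) \<iota>.map_zero add_0 by blast
  have "inverse (ev G) \<in> R"
    using has_value_inverse[OF has_value_ev FG(1)] mem_R_iff by blast
  then have "f1 * inverse (ev G) \<in> R" "f2 * inverse (ev G) \<in> R"
    using f12 by blast+
  moreover have "r = (x - \<iota> a) * (f1 * inverse (ev G)) + (y - \<iota> b) * (f2 * inverse (ev G))"
    unfolding FG(2) f12(3) by (simp add: divide_inverse algebra_simps)
  ultimately show ?thesis using that by blast
qed

text \<open>On the curve, \<open>y - b\<close> and \<open>x - a\<close> are proportional: \<open>(y - b) U = (x - a) W\<close>. The values of \<open>U\<close> and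
\<open>W\<close> at \<open>(a, b)\<close> are, up to sign, the two partial derivatives of the Weierstrass equation, so one of the two is
a unit when the point is nonsingular.\<close>

definition U :: 'k where
  "U = y + \<iota> b + \<iota> (a1 E) * x + \<iota> (a3 E)"

definition W :: 'k where
  "W = x ^ 2 + \<iota> a * x + \<iota> a ^ 2 + \<iota> (a2 E) * (x + \<iota> a) + \<iota> (a4 E) - \<iota> (a1 E) * \<iota> b"

lemma UW_ring [intro]: "U \<in> A" "W \<in> A"
  unfolding U_def W_def by (intro ring_closed ring_power ring_mem)+

lemma UW: "(y - \<iota> b) * U = (x - \<iota> a) * W"
  using equation on_curve_\<iota>[OF on_curve] unfolding U_def W_def by algebra

lemma value_U: "has_value a b U (2 * b + a1 E * a + a3 E)"
proof -
  have "has_value a b U (b + b + a1 E * a + a3 E)"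
    unfolding U_def by (intro has_value_closed has_value_coord)
  then show ?thesis by (simp add: algebra_simps)
qed

lemma value_W: "has_value a b W (3 * a ^ 2 + 2 * a2 E * a + a4 E - a1 E * b)"
proof -
  have "has_value a b W (a * a + a * a + a * a + a2 E * (a + a) + a4 E - a1 E * b)"
    unfolding W_def power2_eq_square by (intro has_value_closed has_value_coord)
  then show ?thesis by (simp add: algebra_simps power2_eq_square)
qed

lemma UW_value_nonzero:
  "2 * b + a1 E * a + a3 E \<noteq> 0 \<or> 3 * a ^ 2 + 2 * a2 E * a + a4 E - a1 E * b \<noteq> 0"
  using on_curve nonsingular unfolding nonsingular_def
  by (metis eq_iff_diff_eq_0 minus_diff_eq)

lemma value_x_minus: "has_value a b (x - \<iota> a) 0"
  using has_value_closed(2)[OF has_value_coord(1) has_value_coord(3)[of a]] by simp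

lemma value_y_minus: "has_value a b (y - \<iota> b) 0"
  using has_value_closed(2)[OF has_value_coord(2) has_value_coord(3)[of b]] by simp

lemma uniformizerI:
  assumes "t \<noteq> 0" "has_value a b t 0" "s1 \<in> R" "s2 \<in> R" "x - \<iota> a = t * s1" "y - \<iota> b = t * s2"
  shows "uniformizer R t"
  unfolding uniformizer_def
proof (intro conjI equalityI subsetI)
  fix r
  assume "r \<in> max_ideal R"
  then obtain f1 f2 where "f1 \<in> R" "f2 \<in> R" "r = (x - \<iota> a) * f1 + (y - \<iota> b) * f2"
    using ideal_generators max_ideal_iff by metis
  then have "r = t * (s1 * f1 + s2 * f2)" "s1 * f1 + s2 * f2 \<in> R"
    unfolding assms(5,6) using assms(3,4) by (auto simp: algebra_simps)
  then show "r \<in> {t * f |f. f \<in> R}" by blast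
next
  fix r
  assume "r \<in> {t * f |f. f \<in> R}"
  then obtain f c where "r = t * f" "has_value a b f c"
    by (auto simp: mem_R_iff)
  then show "r \<in> max_ideal R"
    using has_value_closed(3)[OF assms(2), of f c] by (simp add: max_ideal_iff)
qed (fact assms(1))

text \<open>The choice between \<open>x - a\<close> and \<open>y - b\<close> depends on which of \<open>U\<close>, \<open>W\<close> is a unit. The last conclusion says
that \<open>x - a\<close> has finite order; with norms this extends to all nonzero functions. The order is \<open>1\<close> or,
at a point that is its own inverse, \<open>2\<close>.\<close>

lemma uniformizer_exists:
  obtains t u j where "t \<in> {x - \<iota> a, y - \<iota> b}" "uniformizer R t"
    "u \<in> ring_units R" "x - \<iota> a = u * t ^ j"
proof (cases "2 * b + a1 E * a + a3 E = 0")
  case False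
  then have "U \<in> ring_units R"
    unfolding unit_iff using value_U by blast
  from unit_closed(5)[OF unit_closed(1)[OF this]] unit_closed(6)[OF this]
  have U: "inverse U \<in> R" "U \<noteq> 0" .
  then have "W * inverse U \<in> R"
    by blast
  moreover have "y - \<iota> b = (x - \<iota> a) * (W * inverse U)"
    using arg_cong[OF UW, of "\<lambda>z. z * inverse U"] U(2) by (simp add: mult.assoc)
  ultimately have "uniformizer R (x - \<iota> a)"
    by (intro uniformizerI[OF x_minus_nonzero(1) value_x_minus R_mem[OF ring_mem(7)]]) simp_all
  moreover have "1 \<in> ring_units R"
    unfolding unit_iff using has_value_coord(5) by (intro exI[of _ 1]) auto
  ultimately show ?thesis
    using that[of "x - \<iota> a" 1 1] by simp
next
  case True
  have "W \<in> ring_units R"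
    using True UW_value_nonzero value_W unfolding unit_iff by blast
  from unit_closed(5)[OF unit_closed(1)[OF this]] unit_closed(6)[OF this]
  have W: "inverse W \<in> R" "W \<noteq> 0" .
  then have "U * inverse W \<in> R"
    by blast
  moreover have "x - \<iota> a = (y - \<iota> b) * (U * inverse W)"
    using arg_cong[OF UW, of "\<lambda>z. z * inverse W"] W(2) by (simp add: mult.assoc)
  ultimately have unif: "uniformizer R (y - \<iota> b)"
    by (intro uniformizerI[OF y_minus_nonzero value_y_minus, of "U * inverse W" 1]) (simp_all add: R_mem)
  \<comment> \<open>At such a point \<open>U = (y - b) + a\<^sub>1 (x - a)\<close>; collecting the terms with \<open>x - a\<close> in
    \<open>(y - b) U = (x - a) W\<close> leaves \<open>(x - a) D = (y - b)\<^sup>2\<close> with \<open>D\<close> a unit.\<close>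
  define D where "D = W - \<iota> (a1 E) * (y - \<iota> b)"
  have "has_value a b D (3 * a ^ 2 + 2 * a2 E * a + a4 E - a1 E * b - a1 E * 0)"
    unfolding D_def by (intro has_value_closed value_W value_y_minus has_value_coord)
  then have D: "D \<in> ring_units R"
    using True UW_value_nonzero unfolding unit_iff mult_zero_right diff_zero by blast
  have "2 * \<iota> b + \<iota> (a1 E) * \<iota> a + \<iota> (a3 E) = 0"
    using arg_cong[OF True, of \<iota>] by simp
  then have "(x - \<iota> a) * D = (y - \<iota> b) ^ 2"
    using UW unfolding D_def U_def by algebra
  then have "x - \<iota> a = inverse D * (y - \<iota> b) ^ 2"
    using unit_closed(6)[OF D] by (metis divide_inverse eq_divide_eq mult.commute)
  then show ?thesis
    using that[of "y - \<iota> b" "inverse D" 2] unif unit_closed(1)[OF D] by blast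
qed

lemma uniformizer_D:
  assumes "uniformizer R t"
  shows "t \<noteq> 0" "has_value a b t 0" "t \<in> R" "has_value a b r 0 \<Longrightarrow> \<exists>s\<in>R. r = t * s"
proof -
  show "t \<noteq> 0"
    using assms by (simp add: uniformizer_def)
  have "t * 1 \<in> max_ideal R"
    using assms unfolding uniformizer_def by blast
  then show "has_value a b t 0" "t \<in> R"
    by (auto simp: max_ideal_iff mem_R_iff)
  show "\<exists>s\<in>R. r = t * s" if "has_value a b r 0"
    using assms that unfolding uniformizer_def max_ideal_iff[symmetric] by blast
qed

lemma unit_or_multiple:
  assumes "uniformizer R t" "f \<in> R" "f \<notin> ring_units R"
  shows "\<exists>s\<in>R. f = t * s"
  using assms(2,3) uniformizer_D(4)[OF assms(1), of f] unfolding mem_R_iff unit_iff by metis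

text \<open>A divisor of \<open>t\<^sup>N\<close> is a power of \<open>t\<close> up to a unit: each nonunit is divisible by \<open>t\<close>, and cancelling one
\<open>t\<close> on both sides leaves a divisor of \<open>t\<^sup>N\<^sup>-\<^sup>1\<close>.\<close>

lemma factor_of_power:
  assumes t: "uniformizer R t" and "f \<in> R" "g \<in> R" "u \<in> ring_units R" "f * g = u * t ^ N"
  shows "\<exists>v n. v \<in> ring_units R \<and> f = v * t ^ n"
  using assms(2,3,5)
proof (induction N arbitrary: f)
  case 0
  then have "f * g \<in> ring_units R"
    using assms(4) by simp
  moreover obtain c d where "has_value a b f c" "has_value a b g d"
    using 0 unfolding mem_R_iff by blast
  ultimately have "f \<in> ring_units R"
    unfolding unit_iff using has_value_closed(3) has_value_unique by (metis mult_zero_left)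
  then show ?case
    by (intro exI[of _ f] exI[of _ 0]) simp
next
  case (Suc N)
  show ?case
  proof (cases "f \<in> ring_units R")
    case True
    then show ?thesis
      by (intro exI[of _ f] exI[of _ 0]) simp
  next
    case False
    then obtain s where s: "s \<in> R" "f = t * s"
      using unit_or_multiple t Suc.prems(1) by blast
    then have "s * g = u * t ^ N"
      using Suc.prems(3) uniformizer_D(1)[OF t] by simp
    then obtain v n where "v \<in> ring_units R" "s = v * t ^ n"
      using Suc.IH s(1) Suc.prems(2) by blast
    then show ?thesis
      using s(2) by (intro exI[of _ v] exI[of _ "Suc n"]) simp
  qed
qed

lemma uniformizers_associated:
  assumes "uniformizer R t" "uniformizer R t'"
  obtains w where "w \<in> ring_units R" "t' = w * t"
proof -
  obtain s where s: "s \<in> R" "t' = t * s"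
    using uniformizer_D[OF assms(1)] uniformizer_D[OF assms(2)] by metis
  obtain s' where s': "s' \<in> R" "t = t' * s'"
    using uniformizer_D[OF assms(1)] uniformizer_D[OF assms(2)] by metis
  have "s * s' = 1"
    using s(2) s'(2) uniformizer_D(1)[OF assms(1)]
    by (metis mult.assoc mult.right_neutral mult_cancel_left)
  then have "s \<in> ring_units R"
    using s(1) s'(1) unfolding ring_units_def
    by (metis (mono_tags, lifting) inverse_unique mem_Collect_eq mult_zero_left zero_neq_one)
  then show ?thesis
    using that s(2) by (metis mult.commute)
qed

text \<open>A nonzero \<open>f\<close> divides its norm, a nonzero polynomial in \<open>x\<close>, which is a power of \<open>x - a\<close> up to a unit,
hence a power of \<open>t\<close> up to a unit.\<close>

lemma ring_factorization:
  assumes t: "uniformizer R t" and "f \<in> A" "f \<noteq> 0"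
  obtains u n where "u \<in> ring_units R" "f = u * t ^ n"
proof -
  obtain t' v j where t': "uniformizer R t'" "v \<in> ring_units R" "x - \<iota> a = v * t' ^ j"
    by (metis uniformizer_exists)
  obtain w where w: "w \<in> ring_units R" "t' = w * t"
    using uniformizers_associated[OF t t'(1)] by blast
  obtain g N where g: "g \<in> A" "f * g = of_x N" "N \<noteq> 0"
    using norm_exists assms by metis
  obtain k M where M: "N = [:- a, 1:] ^ k * M" "\<not> [:- a, 1:] dvd M"
    using order_decomp[OF g(3), of a] by blast
  have "of_x M \<in> ring_units R"
    unfolding unit_iff using M(2) has_value_coord(6)[of M] by (metis poly_eq_0_iff_dvd)
  then have "(v * w ^ j) ^ k * of_x M \<in> ring_units R"
    using t'(2) w(1) by blast
  moreover have "f * g = ((v * w ^ j) ^ k * of_x M) * t ^ (j * k)"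
    unfolding g(2) M(1) of_x.map_mult of_x.map_power
    using t'(3) w(2) by (simp add: power_mult_distrib power_mult)
  ultimately show ?thesis
    using factor_of_power[OF t, of f g] assms(2) g(1) that by blast
qed

lemma field_factorization:
  assumes t: "uniformizer R t" and "f \<in> func_field \<iota> x y" "f \<noteq> 0"
  obtains u n where "u \<in> ring_units R" "f = u * t powi n"
proof -
  obtain r s where rs: "r \<in> A" "s \<in> A" "s \<noteq> 0" "f = r / s"
    using assms(2) by (auto simp: func_field_def)
  obtain v i w j where vw: "v \<in> ring_units R" "r = v * t ^ i" "w \<in> ring_units R" "s = w * t ^ j"
    using ring_factorization[OF t] rs assms(3) by (metis div_0)
  have "f = (v * inverse w) * t powi (int i - int j)"
    using rs(4) vw uniformizer_D(1)[OF t] by (simp add: power_int_diff field_simps)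
  then show ?thesis
    using that vw by blast
qed

lemma uniformizer_powi_mem:
  assumes "uniformizer R t"
  shows "t powi n \<in> R \<longleftrightarrow> n \<ge> 0"
proof (cases "n \<ge> 0")
  case True
  then show ?thesis
    using uniformizer_D(3)[OF assms] by (auto simp: power_int_def)
next
  case False
  have t: "t \<noteq> 0" "has_value a b t 0" "t \<in> R"
    using uniformizer_D[OF assms] by auto
  have "t powi n \<notin> R"
  proof
    assume "t powi n \<in> R"
    moreover have "t ^ (nat (- n) - 1) \<in> R"
      using t(3) by blast
    ultimately obtain c where c: "has_value a b (t powi n * t ^ (nat (- n) - 1)) c"
      using R_closed(3) unfolding mem_R_iff by meson
    have "t powi n * t ^ (nat (- n) - 1) * t = t powi n * t powi (- n)"
      using False t(1) by (simp add: power_int_def flip: power_Suc2)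
    also have "\<dots> = 1"
      using t(1) by (simp add: power_int_minus)
    finally have "has_value a b 1 0"
      using has_value_closed(3)[OF c t(2)] by simp
    then show False
      using has_value_unique[OF _ has_value_coord(5)] by fastforce
  qed
  then show ?thesis using False by simp
qed

lemma unit_times_powi_mem:
  assumes "uniformizer R t" "u \<in> ring_units R"
  shows "u * t powi n \<in> R \<longleftrightarrow> n \<ge> 0"
proof -
  have "u * t powi n \<in> R \<longleftrightarrow> t powi n \<in> R"
  proof
    assume "u * t powi n \<in> R"
    then have "inverse u * (u * t powi n) \<in> R"
      using assms(2) unit_closed by blast
    then show "t powi n \<in> R"
      using unit_closed(6)[OF assms(2)] by (simp flip: mult.assoc)
  qed (use assms in blast)
  then show ?thesis
    using uniformizer_powi_mem assms(1) by simp
qed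

lemma ord_at_eq:
  assumes t: "uniformizer R t" and u: "u \<in> ring_units R"
  shows "ord_at \<iota> x y (Affine a b) (u * t powi n) = n"
  unfolding ord_at_def local_ring.simps
proof (rule the_equality)
  fix n'
  assume "\<exists>t' u'. uniformizer R t' \<and> u' \<in> ring_units R \<and> u * t powi n = u' * t' powi n'"
  then obtain t' u' where t': "uniformizer R t'" "u' \<in> ring_units R"
      "u * t powi n = u' * t' powi n'"
    by blast
  obtain w where w: "w \<in> ring_units R" "t' = w * t"
    using uniformizers_associated[OF t t'(1)] by blast
  define v where "v = inverse u * (u' * w powi n')"
  have v: "v \<in> ring_units R" "v \<noteq> 0"
  proof -
    show "v \<in> ring_units R"
      unfolding v_def using u t'(2) w(1) by (intro unit_closed)
    then show "v \<noteq> 0" by (rule unit_closed)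
  qed
  have nz: "u \<noteq> 0" "t \<noteq> 0"
    using unit_closed(6)[OF u] uniformizer_D(1)[OF t] .
  have "inverse u * (u * t powi n) = v * t powi n'"
    unfolding t'(3) v_def w(2) power_int_mult_distrib by (simp only: mult.assoc)
  then have "t powi n = v * t powi n'"
    using nz by (simp flip: mult.assoc)
  then have "t powi (n - n') = v" "t powi (n' - n) = inverse v"
    using nz v(2) by (simp_all add: power_int_diff field_simps)
  then have "t powi (n - n') \<in> R" "t powi (n' - n) \<in> R"
    using unit_closed(5)[OF v(1)] unit_closed(5)[OF unit_closed(1)[OF v(1)]] by simp_all
  then show "n' = n"
    using uniformizer_powi_mem[OF t] by force
qed (use t u in blast)

text \<open>The form in which orders of vanishing are used below: poles of order at most \<open>k\<close> are exactly those
removed by \<open>t\<^sup>k\<close>.\<close>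

lemma ord_at_ge_iff:
  assumes t: "uniformizer R t" and f: "f \<in> func_field \<iota> x y" "f \<noteq> 0"
  shows "ord_at \<iota> x y (Affine a b) f + int k \<ge> 0 \<longleftrightarrow> t ^ k * f \<in> R"
proof -
  obtain u n where un: "u \<in> ring_units R" "f = u * t powi n"
    using field_factorization[OF t f] .
  have "t ^ k * f = u * t powi (n + int k)"
    using un(2) uniformizer_D(1)[OF t] by (simp add: power_int_add)
  then have "t ^ k * f \<in> R \<longleftrightarrow> n + int k \<ge> 0"
    using unit_times_powi_mem[OF t un(1)] by simp
  then show ?thesis
    using ord_at_eq[OF t un(1)] un(2) by simp
qed

end

section \<open>Functions without affine poles and the inverse ideal\<close>

locale smooth_curve = curve_coordinates E \<iota> x y
  for E :: "'a::alg_closed_field weierstrass" and \<iota> :: "'a \<Rightarrow> 'k::field" and x y :: 'k +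
  assumes nonsingular: "nonsingular E"
begin

lemma smooth_point: "on_curve E a b \<Longrightarrow> smooth_point E \<iota> x y a b"
  by unfold_locales (auto intro: nonsingular)

lemma point_above: "\<exists>b. on_curve E a b"
proof -
  have "\<exists>b. poly [:- (a ^ 3 + a2 E * a ^ 2 + a4 E * a + a6 E), a1 E * a + a3 E, 1:] b = 0"
    by (rule alg_closed_imp_poly_has_root) simp
  then show ?thesis
    by (simp add: on_curve_def algebra_simps power2_eq_square)
qed

lemma on_curve_conjugate: "on_curve E a b \<Longrightarrow> on_curve E a (- b - a1 E * a - a3 E)"
  unfolding on_curve_def by algebra

text \<open>Modulo \<open>x - a\<close> the numerator is \<open>r\<^sub>0 + r\<^sub>1 y\<close> with constants \<open>r\<^sub>0\<close>, \<open>r\<^sub>1\<close>, and it vanishes at both points over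
\<open>a\<close>. If these are distinct, \<open>r\<^sub>0 = r\<^sub>1 = 0\<close>. If they coincide, \<open>(y - b) / (x - a)\<close> would be regular at a
point where \<open>U\<close> vanishes, so \<open>W\<close> would vanish too, against nonsingularity.\<close>

lemma quotient_mem_ring:
  assumes s: "s \<in> A"
    and regular: "\<And>b. on_curve E a b \<Longrightarrow> s / (x - \<iota> a) \<in> chart_local_ring \<iota> x y a b"
  shows "s / (x - \<iota> a) \<in> A"
proof -
  obtain b where b: "on_curve E a b"
    using point_above by blast
  define b' where "b' = - b - a1 E * a - a3 E"
  have b': "on_curve E a b'"
    unfolding b'_def using b by (rule on_curve_conjugate)
  interpret P: smooth_point E \<iota> x y a b by (rule smooth_point[OF b])
  interpret P': smooth_point E \<iota> x y a b' by (rule smooth_point[OF b'])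
  obtain f g where fg: "s = of_x f + of_x g * y"
    using s by (rule basis_exists)
  obtain f' g' where fg': "of_x f = \<iota> (poly f a) + (x - \<iota> a) * of_x f'"
    "of_x g = \<iota> (poly g a) + (x - \<iota> a) * of_x g'"
    by (metis of_x_remainder)
  define r0 r1 s' where "r0 = poly f a" and "r1 = poly g a" and "s' = of_x f' + of_x g' * y"
  have s': "s' \<in> A"
    unfolding s'_def by (intro ring_closed ring_mem)
  define \<phi> where "\<phi> = (\<iota> r0 + \<iota> r1 * y) / (x - \<iota> a)"
  have s_eq: "s = (x - \<iota> a) * s' + (\<iota> r0 + \<iota> r1 * y)"
    unfolding fg fg' s'_def r0_def r1_def by (simp add: algebra_simps)
  have quot: "s / (x - \<iota> a) = s' + \<phi>"
    unfolding s_eq \<phi>_def by (simp add: add_divide_distrib)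
  have "s / (x - \<iota> a) - s' \<in> P.R" "s / (x - \<iota> a) - s' \<in> P'.R"
    using regular[OF b] regular[OF b'] s' by blast+
  then have \<phi>: "\<phi> \<in> P.R" "\<phi> \<in> P'.R"
    by (simp_all add: quot)
  have r: "\<iota> r0 + \<iota> r1 * y = (x - \<iota> a) * \<phi>"
    by (simp add: \<phi>_def)
  obtain c where c: "has_value a b \<phi> c"
    using \<phi>(1) P.mem_R_iff by blast
  have "has_value a b (\<iota> r0 + \<iota> r1 * y) (r0 + r1 * b)"
    by (intro P.has_value_closed P.has_value_coord)
  then have 1: "r0 + r1 * b = 0"
    using P.has_value_closed(3)[OF P.value_x_minus c] P.has_value_unique unfolding r by simp
  obtain c' where c': "has_value a b' \<phi> c'"
    using \<phi>(2) P'.mem_R_iff by blast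
  have "has_value a b' (\<iota> r0 + \<iota> r1 * y) (r0 + r1 * b')"
    by (intro P'.has_value_closed P'.has_value_coord)
  then have 2: "r0 + r1 * b' = 0"
    using P'.has_value_closed(3)[OF P'.value_x_minus c'] P'.has_value_unique unfolding r by simp
  have "r1 = 0"
  proof (rule ccontr)
    assume "r1 \<noteq> 0"
    then have "b' = b"
      using 1 2 by (metis add_left_cancel mult_left_cancel)
    moreover have "2 * b + a1 E * a + a3 E = b - b'"
      by (simp add: b'_def)
    ultimately have U0: "2 * b + a1 E * a + a3 E = 0"
      by simp
    have "r0 = - (r1 * b)"
      using 1 by (simp add: eq_neg_iff_add_eq_0)
    then have "\<iota> r1 * (y - \<iota> b) = (x - \<iota> a) * \<phi>"
      using r by (simp add: algebra_simps)
    then have "(x - \<iota> a) * (\<phi> * P.U) = (x - \<iota> a) * (\<iota> r1 * P.W)"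
      using P.UW by algebra
    then have "\<phi> * P.U = \<iota> r1 * P.W"
      by simp
    then have "r1 * (3 * a ^ 2 + 2 * a2 E * a + a4 E - a1 E * b) = 0"
      using P.has_value_closed(3)[OF c P.value_U] P.has_value_unique
        P.has_value_closed(3)[OF P.has_value_coord(3)[of r1] P.value_W] U0 by fastforce
    then show False
      using P.UW_value_nonzero U0 \<open>r1 \<noteq> 0\<close> by simp
  qed
  then have "\<phi> = 0"
    using 1 by (simp add: \<phi>_def)
  then show ?thesis
    using quot s' by simp
qed

text \<open>The roots of a denominator in \<open>L[x]\<close> are cancelled one at a time.\<close>

lemma regular_mem_ring:
  assumes "d \<noteq> 0" "of_x d * f \<in> A"
    and "\<And>a b. on_curve E a b \<Longrightarrow> f \<in> chart_local_ring \<iota> x y a b"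
  shows "f \<in> A"
  using assms
proof (induction "degree d" arbitrary: d f rule: less_induct)
  case (less d f)
  show ?case
  proof (cases "degree d = 0")
    case True
    then obtain c where c: "d = [:c:]" "c \<noteq> 0"
      using less.prems(1) by (metis degree_eq_zeroE pCons_0_0)
    then have "\<iota> (inverse c) * (of_x d * f) \<in> A"
      using less.prems(2) by blast
    moreover have "\<iota> (inverse c) * of_x d = 1"
      using c by (simp flip: \<iota>.map_mult)
    ultimately show ?thesis
      by (simp flip: mult.assoc)
  next
    case False
    then obtain a where "poly d a = 0"
      using alg_closed_imp_poly_has_root by blast
    then obtain e where e: "d = [:- a, 1:] * e"
      by (auto simp: poly_eq_0_iff_dvd elim: dvdE)
    have "e \<noteq> 0"
      using e less.prems(1) by auto
    then have deg: "degree e < degree d"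
      unfolding e by (subst degree_mult_eq) auto
    have d: "of_x d = (x - \<iota> a) * of_x e"
      unfolding e of_x.map_mult by simp
    have nz: "x - \<iota> a \<noteq> 0"
      using \<open>d \<noteq> 0\<close> d of_x_eq_0_iff[of d] by auto
    have quot: "of_x d * f / (x - \<iota> a) = of_x e * f"
      unfolding d using nz by simp
    have "of_x e * f \<in> chart_local_ring \<iota> x y a b" if "on_curve E a b" for b
    proof -
      interpret P: smooth_point E \<iota> x y a b by (rule smooth_point[OF that])
      show ?thesis
        using less.prems(3)[OF that] by blast
    qed
    then have "of_x e * f \<in> A"
      using quotient_mem_ring[OF less.prems(2), of a] unfolding quot by blast
    then show ?thesis
      using less.hyps[OF deg] \<open>e \<noteq> 0\<close> less.prems(3) by blast
  qed
qed

lemma func_field_regular_mem_ring: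
  assumes "f \<in> func_field \<iota> x y"
    and "\<And>a b. on_curve E a b \<Longrightarrow> f \<in> chart_local_ring \<iota> x y a b"
  shows "f \<in> A"
proof -
  obtain r s where rs: "r \<in> A" "s \<in> A" "s \<noteq> 0" "f = r / s"
    using assms(1) by (auto simp: func_field_def)
  obtain g N where g: "g \<in> A" "s * g = of_x N" "N \<noteq> 0"
    using norm_exists rs(2,3) by metis
  have "of_x N * f = r * g"
    unfolding g(2)[symmetric] rs(4) using rs(3) by simp
  then show ?thesis
    using regular_mem_ring[OF g(3)] rs(1) g(1) assms(2) by (metis ring_closed(3))
qed

text \<open>The union over \<open>k\<close> allows poles of every order at infinity, so only the affine points remain.\<close>

lemma inverse_ideal_affine:
  "f \<in> inverse_ideal E \<iota> x y (Affine \<alpha> \<beta>) \<longleftrightarrow>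
     f \<in> func_field \<iota> x y \<and>
     (f = 0 \<or> (\<forall>a b. on_curve E a b \<longrightarrow>
        ord_at \<iota> x y (Affine a b) f + (if a = \<alpha> \<and> b = \<beta> then 1 else 0) \<ge> 0))"
proof -
  have "\<exists>k. ord_at \<iota> x y Infinity f + int k \<ge> 0"
    by (rule exI[of _ "nat (- ord_at \<iota> x y Infinity f)"]) simp
  then show ?thesis
    unfolding inverse_ideal_def riemann_roch_def point_divisor_def curve_points_def
    by auto
qed

lemma func_field_mult_ring:
  assumes "f \<in> func_field \<iota> x y" "g \<in> A"
  shows "g * f \<in> func_field \<iota> x y"
  using assms unfolding func_field_def by force

text \<open>Left to right, \<open>x - \<alpha>\<close> and \<open>y - \<beta>\<close> vanish at \<open>V\<close> and cancel the simple pole, which leaves a function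
without affine poles. Right to left, at each point other than \<open>V\<close> one of \<open>x - \<alpha>\<close>, \<open>y - \<beta>\<close> is a unit, and
at \<open>V\<close> one of them is a uniformizer.\<close>

lemma inverse_ideal_iff:
  assumes V: "on_curve E \<alpha> \<beta>"
  shows "f \<in> inverse_ideal E \<iota> x y (Affine \<alpha> \<beta>) \<longleftrightarrow>
    f \<in> func_field \<iota> x y \<and> (x - \<iota> \<alpha>) * f \<in> A \<and> (y - \<iota> \<beta>) * f \<in> A"
proof (cases "f = 0 \<or> f \<notin> func_field \<iota> x y")
  case True
  then show ?thesis by (auto simp: inverse_ideal_affine)
next
  case False
  then have f: "f \<noteq> 0" "f \<in> func_field \<iota> x y"
    by auto
  interpret V: smooth_point E \<iota> x y \<alpha> \<beta> by (rule smooth_point[OF V])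
  obtain t where t: "t \<in> {x - \<iota> \<alpha>, y - \<iota> \<beta>}" "uniformizer V.R t"
    by (metis V.uniformizer_exists)
  have ord: "f \<in> inverse_ideal E \<iota> x y (Affine \<alpha> \<beta>) \<longleftrightarrow>
      t * f \<in> V.R \<and> (\<forall>a b. on_curve E a b \<and> (a, b) \<noteq> (\<alpha>, \<beta>) \<longrightarrow> f \<in> chart_local_ring \<iota> x y a b)"
  proof -
    have regular: "ord_at \<iota> x y (Affine a b) f \<ge> 0 \<longleftrightarrow> f \<in> chart_local_ring \<iota> x y a b"
      if "on_curve E a b" for a b
    proof -
      interpret P: smooth_point E \<iota> x y a b by (rule smooth_point[OF that])
      obtain s where "uniformizer P.R s"
        by (metis P.uniformizer_exists)
      from P.ord_at_ge_iff[OF this f(2,1), of 0] show ?thesis by simp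
    qed
    have pole: "ord_at \<iota> x y (Affine \<alpha> \<beta>) f + 1 \<ge> 0 \<longleftrightarrow> t * f \<in> V.R"
      using V.ord_at_ge_iff[OF t(2) f(2,1), of 1] by simp
    have "(\<forall>a b. on_curve E a b \<longrightarrow>
          ord_at \<iota> x y (Affine a b) f + (if a = \<alpha> \<and> b = \<beta> then 1 else 0) \<ge> 0) \<longleftrightarrow>
        (\<forall>a b. on_curve E a b \<longrightarrow>
          (if (a, b) = (\<alpha>, \<beta>) then t * f \<in> V.R else f \<in> chart_local_ring \<iota> x y a b))"
      using regular pole by (intro all_cong1 imp_cong) auto
    then show ?thesis
      using f V unfolding inverse_ideal_affine by (metis prod.inject)
  qed
  have "(x - \<iota> \<alpha>) * f \<in> A \<and> (y - \<iota> \<beta>) * f \<in> A"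
    if mem: "f \<in> inverse_ideal E \<iota> x y (Affine \<alpha> \<beta>)"
  proof -
    have "r * f \<in> A" if r: "r \<in> A" "has_value \<alpha> \<beta> r 0" for r
    proof (rule func_field_regular_mem_ring)
      show "r * f \<in> func_field \<iota> x y"
        using f(2) r(1) by (rule func_field_mult_ring)
      fix a b
      assume ab: "on_curve E a b"
      interpret P: smooth_point E \<iota> x y a b by (rule smooth_point[OF ab])
      show "r * f \<in> P.R"
      proof (cases "(a, b) = (\<alpha>, \<beta>)")
        case True
        obtain s where "s \<in> V.R" "r = t * s"
          using V.uniformizer_D(4)[OF t(2) r(2)] by blast
        moreover have "t * f \<in> V.R"
          using ord mem by blast
        ultimately have "s * (t * f) \<in> V.R" "r * f = s * (t * f)"
          by (blast, simp)
        then have "r * f \<in> V.R"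
          by (simp only:)
        then show ?thesis
          using True by auto
      next
        case False
        then show ?thesis
          using ab ord mem r(1) by blast
      qed
    qed
    from this[OF _ V.value_x_minus] this[OF _ V.value_y_minus] show ?thesis
      by (meson ring_closed ring_mem)
  qed
  moreover have "f \<in> inverse_ideal E \<iota> x y (Affine \<alpha> \<beta>)"
    if A: "(x - \<iota> \<alpha>) * f \<in> A" "(y - \<iota> \<beta>) * f \<in> A"
    unfolding ord
  proof (intro conjI allI impI)
    show "t * f \<in> V.R"
      using A t(1) by auto
    fix a b
    assume ab: "on_curve E a b \<and> (a, b) \<noteq> (\<alpha>, \<beta>)"
    then interpret P: smooth_point E \<iota> x y a b by (intro smooth_point) simp
    have unit: "f \<in> P.R" if "r * f \<in> A" "has_value a b r c" "c \<noteq> 0" for r c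
    proof -
      have "r \<in> ring_units P.R"
        using that P.unit_iff by blast
      from P.R_closed(3)[OF P.unit_closed(5)[OF P.unit_closed(1)[OF this]] P.R_mem[OF that(1)]]
        P.unit_closed(6)[OF this]
      have "inverse r * (r * f) \<in> P.R" "r \<noteq> 0" .
      then show ?thesis
        by (simp flip: mult.assoc)
    qed
    have "has_value a b (x - \<iota> \<alpha>) (a - \<alpha>)" "has_value a b (y - \<iota> \<beta>) (b - \<beta>)"
      by (intro P.has_value_closed P.has_value_coord)+
    then show "f \<in> P.R"
      using unit[OF A(1), of "a - \<alpha>"] unit[OF A(2), of "b - \<beta>"] ab by auto
  qed
  ultimately show ?thesis using f by blast
qed

lemma inverse_ideal_module:
  assumes V: "on_curve E \<alpha> \<beta>"
    and "f \<in> inverse_ideal E \<iota> x y (Affine \<alpha> \<beta>)" "r \<in> A"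
  shows "r * f \<in> inverse_ideal E \<iota> x y (Affine \<alpha> \<beta>)"
proof -
  have "r * ((x - \<iota> \<alpha>) * f) \<in> A" "r * ((y - \<iota> \<beta>) * f) \<in> A" "r * f \<in> func_field \<iota> x y"
    using assms(2,3) func_field_mult_ring unfolding inverse_ideal_iff[OF V] by (auto simp: ring_closed)
  then show ?thesis
    unfolding inverse_ideal_iff[OF V] by (simp add: mult.left_commute)
qed

end

section \<open>The twist as a field endomorphism\<close>

lemma frobenius_ring_map:
  assumes "prime CHAR('a::field)" "q = CHAR('a) ^ n"
  shows "ring_map (\<lambda>c::'a. c ^ q)"
proof
  show "(0::'a) ^ q = 0"
    using assms by (simp add: prime_gt_0_nat)
qed (use freshmans_dream'[OF assms] in \<open>auto simp: power_mult_distrib\<close>)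

locale frobenius_curve = smooth_curve E \<iota> x y
  for E :: "'a::alg_closed_field weierstrass" and \<iota> :: "'a \<Rightarrow> 'k::field" and x y :: 'k +
  fixes q :: nat
  assumes frobenius: "ring_map (\<lambda>c::'a. c ^ q)"
    and over_Fq: "defined_over_Fq q E"
begin

sublocale frob: ring_map "\<lambda>c::'a. c ^ q"
  by (rule frobenius)

text \<open>\<open>(c ^ k) ^ q = (c ^ q) ^ k\<close> loops as a rewrite rule when \<open>k\<close> is \<open>q\<close>.\<close>

declare frob.map_power [simp del]

sublocale frobs: ring_map "map_poly (\<lambda>c::'a. c ^ q)"
  by (rule frob.ring_map_coeffs)

sublocale cf: ring_map "coeff_frob q :: 'a poly poly \<Rightarrow> _"
proof -
  have "coeff_frob q = (map_poly (map_poly (\<lambda>c::'a. c ^ q)))"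
    by (simp add: coeff_frob_def fun_eq_iff)
  then show "ring_map (coeff_frob q :: 'a poly poly \<Rightarrow> _)"
    using frobs.ring_map_coeffs by simp
qed

abbreviation K :: "'k set" where
  "K \<equiv> func_field \<iota> x y"

abbreviation tw :: "'k \<Rightarrow> 'k" where
  "tw \<equiv> twist q \<iota> x y"

lemma q_pos: "q > 0"
  using frob.map_zero by (metis neq0_conv power_0 zero_neq_one)

lemma cf_pCons [simp]: "coeff_frob q (pCons f F) = pCons (map_poly (\<lambda>c. c ^ q) f) (coeff_frob q F)"
  by (simp add: coeff_frob_def map_poly_pCons)

lemma frobs_pCons [simp]:
  "map_poly (\<lambda>c. c ^ q) (pCons c f) = pCons (c ^ q) (map_poly (\<lambda>c. c ^ q) f)" for c :: 'a
  by (simp add: map_poly_pCons)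

lemma cf_wpoly: "coeff_frob q (wpoly E) = wpoly E"
  using over_Fq by (simp add: wpoly_def defined_over_Fq_def Fq_def)

lemma frob_eq_0_iff: "(c::'a) ^ q = 0 \<longleftrightarrow> c = 0"
  using q_pos by simp

lemma cf_eq_0_iff: "coeff_frob q F = 0 \<longleftrightarrow> F = (0 :: 'a poly poly)"
proof
  assume 0: "coeff_frob q F = 0"
  show "F = 0"
  proof (intro poly_eqI)
    fix i j
    have "coeff (coeff (coeff_frob q F) i) j = 0"
      using 0 by simp
    then show "coeff (coeff F i) j = coeff (coeff 0 i) j"
      by (simp add: coeff_frob_def coeff_map_poly frob_eq_0_iff)
  qed
qed simp

text \<open>Over an algebraically closed field every coefficient has a \<open>q\<close>-th root.\<close>

lemma cf_surj: "\<exists>F'. coeff_frob q F' = (F :: 'a poly poly)"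
proof -
  define r where "r c = (SOME d. d ^ q = c)" for c :: 'a
  have r: "r c ^ q = c" for c
    unfolding r_def using nth_root_exists[OF q_pos] by (rule someI_ex)
  then have "r 0 = 0"
    using frob_eq_0_iff by blast
  then have "coeff_frob q (map_poly (map_poly r) F) = F"
    by (intro poly_eqI) (simp add: coeff_frob_def coeff_map_poly r)
  then show ?thesis ..
qed

text \<open>The Weierstrass polynomial is fixed by the twist, so the twist preserves its multiples; as the twist
is bijective on polynomials, it also reflects them. This makes the twist of fractions well defined
and injective.\<close>

lemma ev_cf_eq_0_iff: "ev (coeff_frob q F) = 0 \<longleftrightarrow> ev F = 0"
proof
  assume "ev F = 0"
  then obtain H where "F = wpoly E * H"
    by (auto simp: ev_eq_0_iff)
  then have "coeff_frob q F = wpoly E * coeff_frob q H"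
    by (simp add: cf_wpoly)
  then show "ev (coeff_frob q F) = 0"
    by (simp add: ev_eq_0_iff)
next
  assume "ev (coeff_frob q F) = 0"
  then obtain H where H: "coeff_frob q F = wpoly E * H"
    by (auto simp: ev_eq_0_iff)
  obtain H' where "H = coeff_frob q H'"
    using cf_surj by metis
  then have "coeff_frob q (F - wpoly E * H') = 0"
    using H by (simp add: cf_wpoly)
  then have "F - wpoly E * H' = 0"
    by (simp only: cf_eq_0_iff)
  then have "F = wpoly E * H'"
    by simp
  then show "ev F = 0"
    by (simp add: ev_eq_0_iff)
qed

lemma twist_quotient:
  assumes "ev G \<noteq> 0"
  shows "tw (ev F / ev G) = ev (coeff_frob q F) / ev (coeff_frob q G)"
  unfolding twist_def
proof (rule the_equality)
  fix h
  assume "\<exists>F' G'. ev G' \<noteq> 0 \<and> ev F / ev G = ev F' / ev G' \<and>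
    h = ev (coeff_frob q F') / ev (coeff_frob q G')"
  then obtain F' G' where FG: "ev G' \<noteq> 0" "ev F / ev G = ev F' / ev G'"
    "h = ev (coeff_frob q F') / ev (coeff_frob q G')"
    by blast
  then have "ev (F * G' - F' * G) = 0"
    using assms by (simp add: frac_eq_eq)
  then have "ev (coeff_frob q (F * G' - F' * G)) = 0"
    by (simp only: ev_cf_eq_0_iff)
  then show "h = ev (coeff_frob q F) / ev (coeff_frob q G)"
    using FG assms by (simp add: frac_eq_eq ev_cf_eq_0_iff)
qed (use assms in blast)

lemma func_field_cases:
  assumes "f \<in> K"
  obtains F G where "ev G \<noteq> 0" "f = ev F / ev G"
  using assms by (auto simp: func_field_def coord_ring_def)

lemma func_field_quotient: "ev G \<noteq> 0 \<Longrightarrow> ev F / ev G \<in> K"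
  by (auto simp: func_field_def)

lemma func_field_mem [intro]: "f \<in> A \<Longrightarrow> f \<in> K"
  using func_field_quotient[of 1] by (auto simp: coord_ring_def)

lemma twist_ev [simp]: "tw (ev F) = ev (coeff_frob q F)"
  using twist_quotient[of 1 F] by simp

lemma twist_coord [simp]:
  "tw x = x" "tw y = y" "tw (\<iota> c) = \<iota> (c ^ q)" "tw 0 = 0" "tw 1 = 1"
  using twist_ev[of "[:[:0, 1:]:]"] twist_ev[of "[:0, 1:]"] twist_ev[of "[:[:c:]:]"]
    twist_ev[of 0] twist_ev[of 1] by (simp_all add: frob.map_one del: twist_ev)

lemma twist_ring: "f \<in> A \<Longrightarrow> tw f \<in> A"
  by (auto simp: coord_ring_def)

lemma func_field_closed [intro]:
  assumes "f \<in> K" "g \<in> K"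
  shows "f + g \<in> K" "f - g \<in> K" "f * g \<in> K" "f / g \<in> K"
proof -
  obtain F G F' G' where FG: "ev G \<noteq> 0" "f = ev F / ev G" "ev G' \<noteq> 0" "g = ev F' / ev G'"
    using assms by (elim func_field_cases)
  show "f + g \<in> K" "f - g \<in> K" "f * g \<in> K"
    using func_field_quotient[of "G * G'" "F * G' + F' * G"] func_field_quotient[of "G * G'" "F * G' - F' * G"]
      func_field_quotient[of "G * G'" "F * F'"] FG by (simp_all add: add_frac_eq diff_frac_eq)
  show "f / g \<in> K"
    using func_field_quotient[of "G * F'" "F * G'"] FG by (cases "ev F' = 0") auto
qed

lemma twist_closed:
  assumes "f \<in> K" "g \<in> K"
  shows "tw (f + g) = tw f + tw g" "tw (f - g) = tw f - tw g" "tw (f * g) = tw f * tw g"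
    "tw (f / g) = tw f / tw g"
proof -
  obtain F G F' G' where FG: "ev G \<noteq> 0" "f = ev F / ev G" "ev G' \<noteq> 0" "g = ev F' / ev G'"
    using assms by (elim func_field_cases)
  have cf: "ev (coeff_frob q G) \<noteq> 0" "ev (coeff_frob q G') \<noteq> 0"
    using FG by (simp_all add: ev_cf_eq_0_iff)
  show "tw (f + g) = tw f + tw g" "tw (f - g) = tw f - tw g" "tw (f * g) = tw f * tw g"
    using twist_quotient[of "G * G'" "F * G' + F' * G"] twist_quotient[of "G * G'" "F * G' - F' * G"]
      twist_quotient[of "G * G'" "F * F'"] FG cf twist_quotient[of G F] twist_quotient[of G' F']
    by (simp_all add: add_frac_eq diff_frac_eq)
  show "tw (f / g) = tw f / tw g"
    using twist_quotient[of "G * F'" "F * G'"] FG cf twist_quotient[of G F] twist_quotient[of G' F']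
      ev_cf_eq_0_iff[of F']
    by (cases "ev F' = 0") auto
qed

lemma inverse_ideal_add:
  assumes V: "on_curve E \<alpha> \<beta>"
    and "f \<in> inverse_ideal E \<iota> x y (Affine \<alpha> \<beta>)" "g \<in> inverse_ideal E \<iota> x y (Affine \<alpha> \<beta>)"
  shows "f + g \<in> inverse_ideal E \<iota> x y (Affine \<alpha> \<beta>)"
  using assms(2,3) unfolding inverse_ideal_iff[OF V] distrib_left by auto

lemma twist_mem: "f \<in> K \<Longrightarrow> tw f \<in> K"
  by (elim func_field_cases) (auto simp: twist_quotient intro!: func_field_quotient simp: ev_cf_eq_0_iff)

end

section \<open>The line through the three points\<close>

text \<open>The abscissae \<open>a\<close>, \<open>A\<close>, \<open>\<theta>\<close> are the roots of the cubic obtained by restricting the equation to the line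
of slope \<open>m\<close> through \<open>(A, B)\<close>; the conclusion compares the second symmetric functions. As \<open>\<theta>\<close> is
defined by the first one, it suffices to divide the difference of the two curve equations by
\<open>A - a\<close>.\<close>

lemma line_meets_curve:
  assumes "on_curve E a b" "on_curve E A B" "A \<noteq> a" "B - b = m * (A - a)"
    and "\<theta> = m ^ 2 + a1 E * m - a2 E - a - A"
  shows "a4 E - 2 * m * (B - m * A) - a1 E * (B - m * A) - a3 E * m = a * A + a * \<theta> + A * \<theta>"
proof -
  have "(A - a) * (a4 E - 2 * m * (B - m * A) - a1 E * (B - m * A) - a3 E * m
          - (a * A + a * \<theta> + A * \<theta>)) = 0"
    using assms(1,2,4,5) unfolding on_curve_def by algebra
  then show ?thesis
    using assms(3) by simp
qed

text \<open>Here \<open>K\<close>, \<open>A\<close>, \<open>B\<close> stand for \<open>\<kappa>\<^sup>q\<close>, \<open>\<alpha>\<^sup>q\<close>, \<open>\<beta>\<^sup>q\<close> and \<open>X1\<close>, \<open>X2\<close> for \<open>\<chi>\<^sub>1\<^sup>q\<close>, \<open>\<chi>\<^sub>2\<^sup>q\<close>. The first identity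
is the formula for \<open>\<theta>\<close>; in the second \<open>k\<close> cancels, and what remains is \<open>line_meets_curve\<close>.\<close>

lemma coefficient_identities:
  assumes on: "on_curve E a b" "on_curve E A B" and ne: "A \<noteq> a"
    and b': "b' = - b - a1 E * a - a3 E" and B': "B' = - B - a1 E * A - a3 E"
    and slope: "B - b' = m * (A - a)"
    and \<theta>: "\<theta> = m ^ 2 + a1 E * m - a2 E - a - A"
    and \<gamma>1: "\<gamma>1 = (K + m + a1 E) * (m - k) - \<theta>" and \<gamma>2: "\<gamma>2 = - K - m - a1 E"
    and u: "u = K - k" and v: "v = B' - b' - K * A + k * a"
    and X1: "X1 = K ^ 2 + a1 E * K - a2 E - A"
    and X2: "X2 = a4 E - 2 * K * B' + K ^ 2 * A - a1 E * B' - a3 E * K + a2 E * A + A ^ 2"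
  shows "- X1 - \<gamma>1 = u * \<gamma>2 - a" "X2 = v * \<gamma>2 - a * \<gamma>1"
proof -
  show "- X1 - \<gamma>1 = u * \<gamma>2 - a"
    unfolding X1 \<gamma>1 \<gamma>2 u \<theta> by algebra
  have "on_curve E a b'"
    using on(1) unfolding on_curve_def b' by algebra
  from line_meets_curve[OF this on(2) ne slope \<theta>]
  have e2: "a4 E - 2 * m * (B - m * A) - a1 E * (B - m * A) - a3 E * m
    = a * A + a * \<theta> + A * \<theta>" .
  have "v * \<gamma>2 - a * \<gamma>1 = \<gamma>2 * (B' - B + A * (m - K)) + a * \<theta>"
    using slope unfolding v \<gamma>1 \<gamma>2 by algebra
  then show "X2 = v * \<gamma>2 - a * \<gamma>1"
    using e2 \<theta> unfolding X2 B' \<gamma>2 by algebra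
qed

text \<open>With \<open>l = \<lambda>\<^sub>1\<^sup>q\<^sup>+\<^sup>1\<close> and \<open>d = \<delta>\<close>, the first and third condition are a triangular system for \<open>d\<close> and
\<open>l\<close>; its solution satisfies the other two by the assumed identities.\<close>

lemma conditions_equiv:
  fixes X1 X2 \<gamma>1 \<gamma>2 u v a l d :: "'a::field"
  assumes "- X1 - \<gamma>1 = u * \<gamma>2 - a" "X2 = v * \<gamma>2 - a * \<gamma>1"
  shows "(- X1 = d + \<gamma>1 \<and> X2 = d * \<gamma>1 - l * \<gamma>2 \<and> - (u * X1) = l + u * d + v \<and> u * X2 = d * v - l * a)
     \<longleftrightarrow> (l = u * \<gamma>1 - v \<and> d = - X1 - \<gamma>1)"
proof (intro iffI; elim conjE)
  assume "- X1 = d + \<gamma>1" "- (u * X1) = l + u * d + v"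
  then show "l = u * \<gamma>1 - v \<and> d = - X1 - \<gamma>1"
    by (intro conjI; algebra)
next
  assume "l = u * \<gamma>1 - v" "d = - X1 - \<gamma>1"
  then show "- X1 = d + \<gamma>1 \<and> X2 = d * \<gamma>1 - l * \<gamma>2 \<and> - (u * X1) = l + u * d + v \<and>
      u * X2 = d * v - l * a"
    using assms by (intro conjI; algebra)
qed

text \<open>A nonzero polynomial in \<open>X\<close> alone is not divisible by the Weierstrass polynomial.\<close>

lemma generic_point_transcendental:
  assumes "generic_point q E \<theta> \<eta>" "f \<noteq> 0" "\<And>i. coeff f i \<in> Fq q" "0 < q"
  shows "poly f \<theta> \<noteq> 0"
proof
  assume "poly f \<theta> = 0"
  moreover have "\<forall>i j. coeff (coeff [:f:] i) j \<in> Fq q"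
    using assms(3,4) by (auto simp: coeff_pCons Fq_def split: nat.split)
  ultimately have "wpoly E dvd [:f:]"
    using assms(1) unfolding generic_point_def by (metis at_point_pCons at_point.map_zero mult_zero_right add_0_right)
  then have "degree (wpoly E) \<le> degree [:f:]"
    using assms(2) by (intro dvd_imp_degree_le) auto
  then show False
    by (simp add: wpoly_def)
qed

lemma points_over_same_abscissa:
  assumes "on_curve E a b" "on_curve E a c" "c \<noteq> b"
  shows "c = - b - a1 E * a - a3 E"
proof -
  have "(c - b) * (c - (- b - a1 E * a - a3 E)) = 0"
    using assms(1,2) unfolding on_curve_def by algebra
  then show ?thesis
    using assms(3) by simp
qed

context frobenius_curve begin

lemma on_curve_frob: "on_curve E a b \<Longrightarrow> on_curve E (a ^ q) (b ^ q)"
proof -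
  assume "on_curve E a b"
  from arg_cong[OF this[unfolded on_curve_def], of "\<lambda>c. c ^ q"]
  show ?thesis
    using over_Fq unfolding on_curve_def frob.map_add frob.map_mult frob.map_power
    by (simp add: defined_over_Fq_def Fq_def)
qed

lemma frob_fixes: "a1 E ^ q = a1 E" "a2 E ^ q = a2 E" "a3 E ^ q = a3 E" "a4 E ^ q = a4 E"
  using over_Fq by (simp_all add: defined_over_Fq_def Fq_def)

text \<open>The polynomial \<open>X\<^bsup>q\<^sup>2\<^esup> - X\<close> does not vanish at \<open>\<theta>\<close>.\<close>

lemma generic_point_frob2:
  assumes "generic_point q E \<theta> \<eta>" "q > 1"
  shows "(\<theta> ^ q) ^ q \<noteq> \<theta>"
proof -
  define f :: "'a poly" where "f = monom 1 (q * q) - monom 1 1"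
  have qq: "q * q \<noteq> 1"
    using assms(2) by simp
  then have "coeff f 1 \<noteq> 0"
    by (simp add: f_def)
  then have "f \<noteq> 0"
    by auto
  moreover have "coeff f i \<in> Fq q" for i
    by (simp add: f_def Fq_def frob_eq_0_iff)
  ultimately have "poly f \<theta> \<noteq> 0"
    using assms(2) by (intro generic_point_transcendental[OF assms(1)]) simp_all
  then show ?thesis
    by (simp add: f_def poly_monom power_mult)
qed

text \<open>If the abscissa were fixed, the twist of \<open>V\<close> would be \<open>V\<close> or its inverse. In the first case the sum is the
point at infinity; in the second it is \<open>2V\<close>, which is fixed by the square of the twist, as \<open>V\<close> is.\<close>

lemma frob_moves_point:
  assumes gen: "generic_point q E \<theta> \<eta>" and q: "q > 1"
    and on: "on_curve E \<alpha> \<beta>"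
    and sum: "padd E (Affine \<alpha> \<beta>) (pneg E (frob_point q (Affine \<alpha> \<beta>))) = Affine \<theta> \<eta>"
  shows "\<alpha> ^ q \<noteq> \<alpha>"
proof
  assume \<alpha>: "\<alpha> ^ q = \<alpha>"
  have ne: "\<beta> ^ q \<noteq> \<beta>"
    using sum \<alpha> by (auto simp: frob_point_def)
  have "on_curve E \<alpha> (\<beta> ^ q)"
    using on_curve_frob[OF on] \<alpha> by simp
  then have 1: "\<beta> ^ q = - \<beta> - a1 E * \<alpha> - a3 E"
    using on ne by (intro points_over_same_abscissa)
  have "(\<beta> ^ q) ^ q = \<beta>"
    by (subst 1) (simp add: frob_fixes \<alpha> 1)
  define s where "s = (3 * \<alpha> ^ 2 + 2 * a2 E * \<alpha> + a4 E - a1 E * \<beta>) / (2 * \<beta> + a1 E * \<alpha> + a3 E)"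
  have "(s ^ q) ^ q = s"
    by (simp add: s_def power_divide frob.map_power[of _ 2] frob_fixes \<alpha> \<open>(\<beta> ^ q) ^ q = \<beta>\<close>)
  moreover have "\<theta> = s ^ 2 + a1 E * s - a2 E - \<alpha> - \<alpha>"
    using sum \<alpha> ne by (simp add: frob_point_def Let_def s_def)
  ultimately have "(\<theta> ^ q) ^ q = \<theta>"
    by (simp add: frob.map_power[of _ 2] frob_fixes \<alpha>)
  then show False
    using generic_point_frob2[OF gen q] by simp
qed

text \<open>The addition law uses the line through \<open>V\<close> and the inverse of the twist of \<open>V\<close>; \<open>m\<close> belongs to the
line through the inverses of these two points, whence the slope \<open>-m - a\<^sub>1\<close> in the proof.\<close>

lemma theta_eq:
  assumes "\<alpha> ^ q \<noteq> \<alpha>"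
    and sum: "padd E (Affine \<alpha> \<beta>) (pneg E (frob_point q (Affine \<alpha> \<beta>))) = Affine \<theta> \<eta>"
    and m: "\<beta> ^ q - (- \<beta> - a1 E * \<alpha> - a3 E) = m * (\<alpha> ^ q - \<alpha>)"
  shows "\<theta> = m ^ 2 + a1 E * m - a2 E - \<alpha> - \<alpha> ^ q"
proof -
  define s where "s = (- (\<beta> ^ q) - a1 E * \<alpha> ^ q - a3 E - \<beta>) / (\<alpha> ^ q - \<alpha>)"
  have "s * (\<alpha> ^ q - \<alpha>) = - (\<beta> ^ q - (- \<beta> - a1 E * \<alpha> - a3 E)) - a1 E * (\<alpha> ^ q - \<alpha>)"
  proof -
    have "s * (\<alpha> ^ q - \<alpha>) = - (\<beta> ^ q) - a1 E * \<alpha> ^ q - a3 E - \<beta>"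
      using assms(1) by (simp add: s_def)
    then show ?thesis
      by (simp add: algebra_simps)
  qed
  also have "\<dots> = (- m - a1 E) * (\<alpha> ^ q - \<alpha>)"
    unfolding m by (simp add: algebra_simps)
  finally have s: "s = - m - a1 E"
    using assms(1) by simp
  have \<theta>: "\<theta> = s ^ 2 + a1 E * s - a2 E - \<alpha> - \<alpha> ^ q"
    using sum assms(1) by (simp add: frob_point_def Let_def s_def split: if_splits)
  show ?thesis
    unfolding \<theta> s by (simp add: power2_eq_square algebra_simps)
qed

end

section \<open>Lines, their norms, and divisibility\<close>

lemma monic_quadratic_dvd_iff:
  fixes n0 n1 r0 r1 r2 :: "'a::field"
  shows "[:n0, n1, 1:] dvd [:r0, r1, r2:] \<longleftrightarrow> r0 = r2 * n0 \<and> r1 = r2 * n1"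
proof
  assume "[:n0, n1, 1:] dvd [:r0, r1, r2:]"
  then obtain g where g: "[:r0, r1, r2:] = [:n0, n1, 1:] * g"
    by (elim dvdE)
  have "degree g = 0"
  proof (cases "g = 0")
    case False
    then have "degree ([:n0, n1, 1:] * g) = 2 + degree g"
      by (subst degree_mult_eq) auto
    then show ?thesis
      unfolding g[symmetric] by (auto split: if_splits)
  qed simp
  then obtain c where "g = [:c:]"
    by (elim degree_eq_zeroE)
  then show "r0 = r2 * n0 \<and> r1 = r2 * n1"
    using g by auto
next
  assume "r0 = r2 * n0 \<and> r1 = r2 * n1"
  then have "[:r0, r1, r2:] = [:n0, n1, 1:] * [:r2:]"
    by simp
  then show "[:n0, n1, 1:] dvd [:r0, r1, r2:]"
    by (metis dvd_triv_left)
qed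

context curve_coordinates begin

text \<open>Compare the coefficients of \<open>y\<close>: since \<open>y\<close> occurs with coefficient \<open>1\<close> in the first factor, the
coefficient of \<open>y\<close> in the quotient must be \<open>Q / N\<close>.\<close>

lemma fraction_mem_ring_iff:
  assumes "N \<noteq> 0"
  shows "(of_x k + y) / of_x N * of_x Q \<in> A \<longleftrightarrow> N dvd Q"
proof
  assume "(of_x k + y) / of_x N * of_x Q \<in> A"
  then obtain f g where "(of_x k + y) / of_x N * of_x Q = of_x f + of_x g * y"
    by (rule basis_exists)
  then have "(of_x k + y) * of_x Q = of_x N * (of_x f + of_x g * y)"
    using assms by (simp add: field_simps)
  then have "of_x (k * Q) + of_x Q * y = of_x (N * f) + of_x (N * g) * y"
    by (simp add: algebra_simps)
  then have "Q = N * g"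
    using basis_unique by blast
  then show "N dvd Q" by simp
next
  assume "N dvd Q"
  then obtain g where "Q = N * g"
    by (elim dvdE)
  then have "(of_x k + y) / of_x N * of_x Q = (of_x k + y) * of_x g"
    using assms by simp
  then show "(of_x k + y) / of_x N * of_x Q \<in> A"
    by (simp add: ring_closed)
qed

lemma conjugate_factorization:
  assumes "on_curve E a b" "b' = - b - a1 E * a - a3 E"
  shows "(y - \<iota> b) * (y - \<iota> b') = (x - \<iota> a) *
    (x ^ 2 + \<iota> a * x + \<iota> a ^ 2 + \<iota> (a2 E) * (x + \<iota> a) + \<iota> (a4 E) - \<iota> (a1 E) * y)"
proof -
  have "\<iota> b' = - \<iota> b - \<iota> (a1 E) * \<iota> a - \<iota> (a3 E)"
    unfolding assms(2) by simp
  then show ?thesis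
    using equation on_curve_\<iota>[OF assms(1)] by algebra
qed

text \<open>The first factor is, up to sign, the conjugate of the second, so the left side is minus the norm of
the line of slope \<open>k\<close> through \<open>(a, b')\<close>.\<close>

lemma norm_of_line:
  assumes "on_curve E a b" "b' = - b - a1 E * a - a3 E"
    and "X1 = k ^ 2 + a1 E * k - a2 E - a"
    and "X2 = a4 E - 2 * k * b' + k ^ 2 * a - a1 E * b' - a3 E * k + a2 E * a + a ^ 2"
  shows "(y + \<iota> (k + a1 E) * (x - \<iota> a) - \<iota> b) * (y - \<iota> b' - \<iota> k * (x - \<iota> a))
    = (x - \<iota> a) * (x ^ 2 - \<iota> X1 * x + \<iota> X2)"
proof -
  have "\<iota> b' = - \<iota> b - \<iota> (a1 E) * \<iota> a - \<iota> (a3 E)"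
    unfolding assms(2) by simp
  moreover have "\<iota> X1 = \<iota> k ^ 2 + \<iota> (a1 E) * \<iota> k - \<iota> (a2 E) - \<iota> a"
    unfolding assms(3) by simp
  moreover have "\<iota> X2 = \<iota> (a4 E) - 2 * \<iota> k * \<iota> b' + \<iota> k ^ 2 * \<iota> a - \<iota> (a1 E) * \<iota> b'
     - \<iota> (a3 E) * \<iota> k + \<iota> (a2 E) * \<iota> a + \<iota> a ^ 2"
    unfolding assms(4) by simp
  ultimately show ?thesis
    using equation on_curve_\<iota>[OF assms(1)] unfolding \<iota>.map_add by algebra
qed

lemma line_nonzero: "y - \<iota> b - \<iota> k * (x - \<iota> a) \<noteq> 0"
  using basis_unique_0[of "[:k * a - b, - k:]" 1] by (auto simp: algebra_simps)

end

section \<open>Stability of the tau-action\<close>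

text \<open>The relation \<open>V - V\<^sup>(\<^sup>1\<^sup>) = \<xi>\<close> enters through \<open>moves\<close> and the formula for \<open>\<theta>\<close>; see
\<open>frob_moves_point\<close> and \<open>theta_eq\<close>. The slope is given without division, as the ring identities use it.\<close>

locale tau_action = frobenius_curve E \<iota> x y q
  for E :: "'a::alg_closed_field weierstrass" and \<iota> :: "'a \<Rightarrow> 'k::field" and x y :: 'k and q :: nat +
  fixes \<alpha> \<beta> \<beta>' \<kappa> lam1 lam2 m \<theta> \<gamma>1 \<gamma>2 \<chi>1 \<chi>2 u v :: 'a and h T1 T2 :: 'k
  assumes V: "on_curve E \<alpha> \<beta>" and moves: "\<alpha> ^ q \<noteq> \<alpha>"
    and lam1: "lam1 \<noteq> 0"
    and \<beta>': "\<beta>' = - \<beta> - a1 E * \<alpha> - a3 E"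
    and slope: "\<beta> ^ q - \<beta>' = m * (\<alpha> ^ q - \<alpha>)"
    and \<theta>: "\<theta> = m ^ 2 + a1 E * m - a2 E - \<alpha> - \<alpha> ^ q"
    and \<gamma>1: "\<gamma>1 = (\<kappa> ^ q + m + a1 E) * (m - \<kappa>) - \<theta>"
    and \<gamma>2: "\<gamma>2 = - (\<kappa> ^ q) - m - a1 E"
    and \<chi>1: "\<chi>1 = \<kappa> ^ 2 + a1 E * \<kappa> - a2 E - \<alpha>"
    and \<chi>2: "\<chi>2 = a4 E - 2 * \<kappa> * \<beta>' + \<kappa> ^ 2 * \<alpha> - a1 E * \<beta>' - a3 E * \<kappa> + a2 E * \<alpha> + \<alpha> ^ 2"
    and u: "u = \<kappa> ^ q - \<kappa>"
    and v: "v = \<beta>' ^ q - \<beta>' - \<kappa> ^ q * \<alpha> ^ q + \<kappa> * \<alpha>"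
    and h: "h = (x - \<iota> \<alpha>) / (y - \<iota> \<beta>' - \<iota> \<kappa> * (x - \<iota> \<alpha>))"
    and T1: "T1 = tw h * \<iota> (lam1 ^ (q + 1) * \<gamma>2)
               - tw h * (x + \<iota> (lam1 ^ q * lam2 + \<gamma>1 ^ q)) * (x + \<iota> \<gamma>1)"
    and T2: "T2 = tw h * \<iota> (lam1 ^ (q + 1))
               + tw h * (x + \<iota> (lam1 ^ q * lam2 + \<gamma>1 ^ q)) * (1 / h)"
begin

abbreviation \<delta> :: 'a where "\<delta> \<equiv> lam1 ^ q * lam2 + \<gamma>1 ^ q"

text \<open>The twists of \<open>C\<^sub>1'\<close> and \<open>C\<^sub>2\<close>. The second is taken as a polynomial, to serve as a divisor, and the first is
split into \<open>C1tw_x\<close> and \<open>y\<close>, so that \<open>fraction_mem_ring_iff\<close> applies to \<open>C1tw / C2tw\<close>.\<close>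

definition C1tw :: 'k where
  "C1tw = y + \<iota> (\<kappa> ^ q + a1 E) * (x - \<iota> (\<alpha> ^ q)) - \<iota> (\<beta> ^ q)"

definition C2tw :: "'a poly" where "C2tw = [:\<chi>2 ^ q, - (\<chi>1 ^ q), 1:]"

definition C1tw_x :: "'a poly" where
  "C1tw_x = [:- (\<kappa> ^ q + a1 E) * \<alpha> ^ q - \<beta> ^ q, \<kappa> ^ q + a1 E:]"

lemma C2tw_nonzero: "C2tw \<noteq> 0"
  by (simp add: C2tw_def)

lemma C1tw_eq: "C1tw = of_x C1tw_x + y"
  by (simp add: C1tw_def C1tw_x_def algebra_simps)

lemma C1tw_nonzero: "C1tw \<noteq> 0"
  using basis_unique_0[of C1tw_x 1] by (auto simp: C1tw_eq)

lemma V1: "on_curve E (\<alpha> ^ q) (\<beta> ^ q)"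
  using V by (rule on_curve_frob)

lemma \<beta>'_frob: "\<beta>' ^ q = - (\<beta> ^ q) - a1 E * \<alpha> ^ q - a3 E"
  by (simp add: \<beta>' frob_fixes)

lemma \<chi>1_frob: "\<chi>1 ^ q = (\<kappa> ^ q) ^ 2 + a1 E * \<kappa> ^ q - a2 E - \<alpha> ^ q"
  by (simp add: \<chi>1 frob_fixes frob.map_power[of _ 2])

lemma \<chi>2_frob: "\<chi>2 ^ q = a4 E - 2 * \<kappa> ^ q * \<beta>' ^ q + (\<kappa> ^ q) ^ 2 * \<alpha> ^ q - a1 E * \<beta>' ^ q
    - a3 E * \<kappa> ^ q + a2 E * \<alpha> ^ q + (\<alpha> ^ q) ^ 2"
  by (simp add: \<chi>2 frob_fixes frob.map_power[of _ 2])

lemmas identities = coefficient_identities[OF V V1 moves \<beta>' \<beta>'_frob slope \<theta> \<gamma>1 \<gamma>2 u v \<chi>1_frob \<chi>2_frob]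

lemma systems_equivalent:
  "(- (\<chi>1 ^ q) = \<delta> + \<gamma>1 \<and> \<chi>2 ^ q = \<delta> * \<gamma>1 - lam1 ^ (q + 1) * \<gamma>2 \<and>
    - (u * \<chi>1 ^ q) = lam1 ^ (q + 1) + u * \<delta> + v \<and> u * \<chi>2 ^ q = \<delta> * v - lam1 ^ (q + 1) * \<alpha>) \<longleftrightarrow>
   (lam1 ^ (q + 1) = u * \<gamma>1 - v \<and> lam1 ^ q * lam2 = - (\<chi>1 ^ q) - \<gamma>1 ^ q - \<gamma>1)"
proof -
  have "\<delta> = - (\<chi>1 ^ q) - \<gamma>1 \<longleftrightarrow> lam1 ^ q * lam2 = - (\<chi>1 ^ q) - \<gamma>1 ^ q - \<gamma>1"
    by (auto simp: algebra_simps)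
  then show ?thesis
    using conditions_equiv[OF identities] by (simp only:)
qed

lemma h_mem: "h \<in> K"
  unfolding h by (intro func_field_closed func_field_mem ring_mem)

lemma tw_h_line: "tw h = (x - \<iota> (\<alpha> ^ q)) / (y - \<iota> (\<beta>' ^ q) - \<iota> (\<kappa> ^ q) * (x - \<iota> (\<alpha> ^ q)))"
  unfolding h
  by (simp add: twist_closed func_field_closed func_field_mem del: \<iota>.map_power)

lemma norm_C1tw: "C1tw * (y - \<iota> (\<beta>' ^ q) - \<iota> (\<kappa> ^ q) * (x - \<iota> (\<alpha> ^ q))) = (x - \<iota> (\<alpha> ^ q)) * of_x C2tw"
  unfolding C1tw_def norm_of_line[OF V1 \<beta>'_frob \<chi>1_frob \<chi>2_frob]
  by (simp add: C2tw_def algebra_simps power2_eq_square)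

lemma tw_h: "tw h = C1tw / of_x C2tw"
  using norm_C1tw C2tw_nonzero line_nonzero[of "\<beta>' ^ q" "\<kappa> ^ q" "\<alpha> ^ q"]
  unfolding tw_h_line by (simp add: frac_eq_eq mult.commute del: \<iota>.map_power)

lemma T1_eq:
  "T1 = (of_x C1tw_x + y) / of_x C2tw * of_x [:lam1 ^ (q + 1) * \<gamma>2 - \<delta> * \<gamma>1, - (\<delta> + \<gamma>1), - 1:]"
  unfolding T1 tw_h C1tw_eq[symmetric] by (simp add: divide_inverse algebra_simps)

lemma inverse_h: "1 / h = (y - \<iota> \<beta>' - \<iota> \<kappa> * (x - \<iota> \<alpha>)) / (x - \<iota> \<alpha>)"
  by (simp add: h)

text \<open>The line in \<open>1 / h\<close> and its twist differ by \<open>u x + v\<close>, and multiplying \<open>h\<^sup>(\<^sup>1\<^sup>)\<close> by the twisted line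
gives \<open>x - \<alpha>\<^sup>q\<close>.\<close>

lemma T2_eq:
  "(x - \<iota> \<alpha>) * T2 = (x + \<iota> \<delta>) * (x - \<iota> (\<alpha> ^ q)) +
     (of_x C1tw_x + y) / of_x C2tw * of_x [:\<delta> * v - lam1 ^ (q + 1) * \<alpha>, lam1 ^ (q + 1) + u * \<delta> + v, u:]"
proof -
  define l1 where "l1 = y - \<iota> (\<beta>' ^ q) - \<iota> (\<kappa> ^ q) * (x - \<iota> (\<alpha> ^ q))"
  have "l1 \<noteq> 0"
    unfolding l1_def by (rule line_nonzero)
  then have "tw h * l1 = x - \<iota> (\<alpha> ^ q)"
    unfolding tw_h_line l1_def[symmetric] by simp
  moreover have "y - \<iota> \<beta>' - \<iota> \<kappa> * (x - \<iota> \<alpha>) = l1 + \<iota> u * x + \<iota> v"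
    unfolding l1_def u v by (simp add: algebra_simps)
  moreover have "(x - \<iota> \<alpha>) * T2 = tw h * (\<iota> (lam1 ^ (q + 1)) * (x - \<iota> \<alpha>) +
      (x + \<iota> \<delta>) * (y - \<iota> \<beta>' - \<iota> \<kappa> * (x - \<iota> \<alpha>)))"
    using x_minus_nonzero(1)[of \<alpha>] unfolding T2 inverse_h by (simp add: field_simps)
  ultimately have "(x - \<iota> \<alpha>) * T2 = (x + \<iota> \<delta>) * (x - \<iota> (\<alpha> ^ q)) +
      tw h * (\<iota> (lam1 ^ (q + 1)) * (x - \<iota> \<alpha>) + (x + \<iota> \<delta>) * (\<iota> u * x + \<iota> v))"
    by algebra
  then show ?thesis
    unfolding tw_h C1tw_eq[symmetric] by (simp add: algebra_simps)
qed

lemma T1_mem_iff: "T1 \<in> A \<longleftrightarrow>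
    - (\<chi>1 ^ q) = \<delta> + \<gamma>1 \<and> \<chi>2 ^ q = \<delta> * \<gamma>1 - lam1 ^ (q + 1) * \<gamma>2"
proof -
  have "l * g - d * c = - 1 * X2 \<and> - (d + c) = - 1 * - X1 \<longleftrightarrow> - X1 = d + c \<and> X2 = d * c - l * g"
    for l g d c X1 X2 :: 'a
    by (intro iffI conjI; elim conjE; algebra)
  then show ?thesis
    unfolding T1_eq fraction_mem_ring_iff[OF C2tw_nonzero] unfolding C2tw_def monic_quadratic_dvd_iff .
qed

lemma T2_mem_iff: "(x - \<iota> \<alpha>) * T2 \<in> A \<longleftrightarrow>
    - (u * \<chi>1 ^ q) = lam1 ^ (q + 1) + u * \<delta> + v \<and> u * \<chi>2 ^ q = \<delta> * v - lam1 ^ (q + 1) * \<alpha>"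
proof -
  have add: "f + g \<in> A \<longleftrightarrow> g \<in> A" if "f \<in> A" for f g
    using ring_closed(2)[OF _ that, of "f + g"] ring_closed(1)[OF that, of g] by auto
  have "(x + \<iota> \<delta>) * (x - \<iota> (\<alpha> ^ q)) \<in> A"
    by (intro ring_closed ring_mem)
  then show ?thesis
    unfolding T2_eq add[OF \<open>_ \<in> A\<close>] fraction_mem_ring_iff[OF C2tw_nonzero]
    unfolding C2tw_def monic_quadratic_dvd_iff by (auto simp: algebra_simps)
qed

definition W :: 'k where
  "W = x ^ 2 + \<iota> \<alpha> * x + \<iota> \<alpha> ^ 2 + \<iota> (a2 E) * (x + \<iota> \<alpha>) + \<iota> (a4 E) - \<iota> (a1 E) * y"

lemma W_mem: "W \<in> A"
  unfolding W_def by (intro ring_closed ring_power ring_mem)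

lemma W_eq: "(y - \<iota> \<beta>) * (y - \<iota> \<beta>') = (x - \<iota> \<alpha>) * W"
  unfolding W_def using V \<beta>' by (rule conjugate_factorization)

context
  assumes C: "lam1 ^ (q + 1) = u * \<gamma>1 - v" "lam1 ^ q * lam2 = - (\<chi>1 ^ q) - \<gamma>1 ^ q - \<gamma>1"
begin

lemma \<delta>_eq: "\<delta> = u * \<gamma>2 - \<alpha>"
proof -
  have "\<delta> = - (\<chi>1 ^ q) - \<gamma>1"
    unfolding C(2) by simp
  then show ?thesis
    unfolding identities(1) .
qed

lemma coefficient_conditions:
  "- (\<chi>1 ^ q) = \<delta> + \<gamma>1" "\<chi>2 ^ q = \<delta> * \<gamma>1 - lam1 ^ (q + 1) * \<gamma>2"
  "- (u * \<chi>1 ^ q) = lam1 ^ (q + 1) + u * \<delta> + v" "u * \<chi>2 ^ q = \<delta> * v - lam1 ^ (q + 1) * \<alpha>"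
  using systems_equivalent C by blast+

lemma T1_stable: "T1 = - C1tw"
proof -
  have "[:lam1 ^ (q + 1) * \<gamma>2 - \<delta> * \<gamma>1, - (\<delta> + \<gamma>1), - 1:] = - C2tw"
    using coefficient_conditions(1,2) by (simp add: C2tw_def del: power_Suc)
  then show ?thesis
    unfolding T1_eq using C2tw_nonzero by (simp add: C1tw_eq)
qed

lemma T2_stable: "(x - \<iota> \<alpha>) * T2 = (x + \<iota> \<delta>) * (x - \<iota> (\<alpha> ^ q)) + \<iota> u * C1tw"
proof -
  have "[:\<delta> * v - lam1 ^ (q + 1) * \<alpha>, lam1 ^ (q + 1) + u * \<delta> + v, u:] = smult u C2tw"
    using coefficient_conditions(3,4) by (simp add: C2tw_def del: power_Suc)
  then show ?thesis
    unfolding T2_eq using C2tw_nonzero by (simp add: C1tw_eq)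
qed

text \<open>The numerator \<open>(x - \<alpha>) T\<^sub>2\<close> vanishes at the inverse \<open>(\<alpha>, \<beta>')\<close> of \<open>V\<close>, so it is a combination of
\<open>x - \<alpha>\<close> and \<open>y - \<beta>'\<close>. Multiplying by \<open>(y - \<beta>) / (x - \<alpha>)\<close> and using
\<open>(y - \<beta>) (y - \<beta>') = (x - \<alpha>) W\<close> gives the following expression for \<open>(y - \<beta>) T\<^sub>2\<close>, visibly in the
coordinate ring.\<close>

definition S :: 'k where
  "S = (y - \<iota> \<beta>) * (x + \<iota> (\<delta> + \<alpha> - \<alpha> ^ q + u * (\<kappa> ^ q + a1 E))) + \<iota> u * W"

lemma S_mem: "S \<in> A"
  unfolding S_def by (intro ring_closed ring_mem W_mem)

lemma S_eq: "S = (y - \<iota> \<beta>) * T2"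
proof -
  have 1: "(x + \<iota> \<delta>) * (x - \<iota> (\<alpha> ^ q)) + \<iota> u * C1tw =
    (x - \<iota> \<alpha>) * (x + \<iota> (\<delta> + \<alpha> - \<alpha> ^ q + u * (\<kappa> ^ q + a1 E))) + \<iota> u * (y - \<iota> \<beta>')"
  proof -
    have "(\<alpha> + \<delta>) * (\<alpha> - \<alpha> ^ q) + u * ((\<kappa> ^ q + a1 E) * (\<alpha> - \<alpha> ^ q) + \<beta>' - \<beta> ^ q)
      = (\<alpha> - \<alpha> ^ q) * (\<alpha> + \<delta> - u * \<gamma>2) - u * (\<beta> ^ q - \<beta>' - m * (\<alpha> ^ q - \<alpha>))"
      unfolding \<gamma>2 by (simp add: algebra_simps)
    also have "\<dots> = 0"
      using slope \<delta>_eq by simp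
    finally have "\<iota> ((\<alpha> + \<delta>) * (\<alpha> - \<alpha> ^ q) + u * ((\<kappa> ^ q + a1 E) * (\<alpha> - \<alpha> ^ q) + \<beta>' - \<beta> ^ q)) = 0"
      by simp
    then show ?thesis
      unfolding C1tw_def \<iota>.map_add \<iota>.map_diff \<iota>.map_mult by algebra
  qed
  have "(x - \<iota> \<alpha>) * S = (x - \<iota> \<alpha>) * ((y - \<iota> \<beta>) * T2)"
    using T2_stable[unfolded 1] W_eq unfolding S_def by algebra
  then show ?thesis
    using x_minus_nonzero(1) mult_left_cancel by blast
qed

lemma T2_mem_field: "T2 \<in> K"
  unfolding T2 by (intro func_field_closed func_field_mem ring_mem twist_mem h_mem)

text \<open>For \<open>g\<close> in the inverse ideal, \<open>x - \<alpha>\<^sup>q\<close> and \<open>y - \<beta>\<^sup>q\<close> clear the pole of the twist \<open>g\<^sup>(\<^sup>1\<^sup>)\<close>, hence so do all their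
combinations, among them \<open>C1tw\<close> and \<open>(x - \<alpha>) T\<^sub>2\<close>. For \<open>s = (y - \<beta>) T\<^sub>2 g\<^sup>(\<^sup>1\<^sup>)\<close> this shows that
\<open>(x - \<alpha>) s\<close> and \<open>(x - \<alpha>\<^sup>q) s\<close> lie in the coordinate ring, and the difference of the two factors is
a nonzero constant.\<close>

lemma stable_E2:
  assumes g: "g \<in> inverse_ideal E \<iota> x y (Affine \<alpha> \<beta>)"
  shows "tw g * T1 \<in> A" "tw g * T2 \<in> inverse_ideal E \<iota> x y (Affine \<alpha> \<beta>)"
proof -
  have gK: "g \<in> K" and gA: "(x - \<iota> \<alpha>) * g \<in> A" "(y - \<iota> \<beta>) * g \<in> A"
    using g unfolding inverse_ideal_iff[OF V] by auto
  have "tw ((x - \<iota> \<alpha>) * g) = (x - \<iota> (\<alpha> ^ q)) * tw g" "tw ((y - \<iota> \<beta>) * g) = (y - \<iota> (\<beta> ^ q)) * tw g"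
    using gK by (simp_all add: twist_closed func_field_closed func_field_mem)
  then have A1: "(x - \<iota> (\<alpha> ^ q)) * tw g \<in> A" and B1: "(y - \<iota> (\<beta> ^ q)) * tw g \<in> A"
    using twist_ring[OF gA(1)] twist_ring[OF gA(2)] by simp_all
  have "C1tw * tw g = (y - \<iota> (\<beta> ^ q)) * tw g + \<iota> (\<kappa> ^ q + a1 E) * ((x - \<iota> (\<alpha> ^ q)) * tw g)"
    unfolding C1tw_def by (simp add: algebra_simps)
  then have C1tw: "C1tw * tw g \<in> A"
    using ring_closed(1)[OF B1 ring_closed(3)[OF ring_mem(4) A1]] by (simp only:)
  then have "- (C1tw * tw g) \<in> A"
    by (rule ring_minus)
  then show "tw g * T1 \<in> A"
    unfolding T1_stable by (simp add: mult.commute)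
  have "(x - \<iota> \<alpha>) * (tw g * T2) = (x + \<iota> \<delta>) * ((x - \<iota> (\<alpha> ^ q)) * tw g) + \<iota> u * (C1tw * tw g)"
    using T2_stable by algebra
  then have X: "(x - \<iota> \<alpha>) * (tw g * T2) \<in> A"
    using ring_closed(1)[OF ring_closed(3)[OF ring_closed(1)[OF ring_mem(2) ring_mem(4)] A1]
        ring_closed(3)[OF ring_mem(4) C1tw]] by (simp only:)
  have "(y - \<iota> \<beta>) * ((x - \<iota> \<alpha>) * (tw g * T2)) \<in> A" "S * ((x - \<iota> (\<alpha> ^ q)) * tw g) \<in> A"
    by (rule ring_closed(3)[OF _ X], intro ring_closed ring_mem) (rule ring_closed(3)[OF S_mem A1])
  then have "\<iota> (1 / (\<alpha> ^ q - \<alpha>)) *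
      ((y - \<iota> \<beta>) * ((x - \<iota> \<alpha>) * (tw g * T2)) - S * ((x - \<iota> (\<alpha> ^ q)) * tw g)) \<in> A"
    by (rule ring_closed(3)[OF ring_mem(4) ring_closed(2)])
  also have "(y - \<iota> \<beta>) * ((x - \<iota> \<alpha>) * (tw g * T2)) - S * ((x - \<iota> (\<alpha> ^ q)) * tw g) =
      \<iota> (\<alpha> ^ q - \<alpha>) * ((y - \<iota> \<beta>) * (tw g * T2))"
    unfolding S_eq \<iota>.map_diff by algebra
  also have "\<iota> (1 / (\<alpha> ^ q - \<alpha>)) * \<dots> = (y - \<iota> \<beta>) * (tw g * T2)"
  proof -
    have "\<iota> (1 / (\<alpha> ^ q - \<alpha>)) * \<iota> (\<alpha> ^ q - \<alpha>) = 1"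
      using moves by (simp only: \<iota>.map_mult[symmetric]) simp
    then show ?thesis by (simp only: mult.assoc[symmetric] mult_1)
  qed
  finally show "tw g * T2 \<in> inverse_ideal E \<iota> x y (Affine \<alpha> \<beta>)"
    unfolding inverse_ideal_iff[OF V] using X gK T2_mem_field by (auto intro: twist_mem)
qed

text \<open>The value of \<open>C1tw\<close> at \<open>(\<alpha>, \<beta>')\<close> is \<open>-\<gamma>\<^sub>2 (\<alpha> - \<alpha>\<^sup>q)\<close>, so the constants in \<open>\<Upsilon>\<^sub>1\<close> and \<open>\<Upsilon>\<^sub>2\<close> have
denominator \<open>\<gamma>\<^sub>2\<close>. In \<open>\<Upsilon>\<^sub>2 + w \<Upsilon>\<^sub>1\<close> they add up to \<open>(\<alpha> - \<alpha>\<^sup>q + w) / \<gamma>\<^sub>2 = u\<close>; that is what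
singles out \<open>w\<close>.\<close>

lemma T2_residue_formula:
  assumes "\<gamma>2 \<noteq> 0" "w = u * \<gamma>2 + \<alpha> ^ q - \<alpha>"
    and "\<Upsilon>1 = (x - \<iota> (\<alpha> ^ q)) / C1tw - \<iota> ((\<alpha> - \<alpha> ^ q) / value_at \<iota> x y (Affine \<alpha> \<beta>') C1tw)"
    and "\<Upsilon>2 = (x - \<iota> (\<alpha> ^ q)) ^ 2 / C1tw - \<iota> ((\<alpha> - \<alpha> ^ q) ^ 2 / value_at \<iota> x y (Affine \<alpha> \<beta>') C1tw)"
  shows "T2 = C1tw / (x - \<iota> \<alpha>) * (\<Upsilon>2 + \<iota> w * \<Upsilon>1)"
proof -
  interpret V': smooth_point E \<iota> x y \<alpha> \<beta>'
    unfolding \<beta>' by (intro smooth_point on_curve_conjugate V)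
  have "has_value \<alpha> \<beta>' C1tw (\<beta>' + (\<kappa> ^ q + a1 E) * (\<alpha> - \<alpha> ^ q) - \<beta> ^ q)"
    unfolding C1tw_def by (intro V'.has_value_closed V'.has_value_coord)
  also have "\<beta>' + (\<kappa> ^ q + a1 E) * (\<alpha> - \<alpha> ^ q) - \<beta> ^ q = - \<gamma>2 * (\<alpha> - \<alpha> ^ q)"
  proof -
    have "\<beta>' + (\<kappa> ^ q + a1 E) * (\<alpha> - \<alpha> ^ q) - \<beta> ^ q
        = (\<kappa> ^ q + a1 E) * (\<alpha> - \<alpha> ^ q) - (\<beta> ^ q - \<beta>')"
      by simp
    then show ?thesis
      unfolding slope \<gamma>2 by (simp add: algebra_simps)
  qed
  finally have value_C1tw: "value_at \<iota> x y (Affine \<alpha> \<beta>') C1tw = - \<gamma>2 * (\<alpha> - \<alpha> ^ q)"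
    by (rule V'.value_at_eq)
  have \<Upsilon>1: "\<Upsilon>1 = (x - \<iota> (\<alpha> ^ q)) / C1tw + \<iota> (1 / \<gamma>2)"
    and \<Upsilon>2: "\<Upsilon>2 = (x - \<iota> (\<alpha> ^ q)) ^ 2 / C1tw + \<iota> ((\<alpha> - \<alpha> ^ q) / \<gamma>2)"
    unfolding assms(3,4) value_C1tw using moves by (simp_all add: power2_eq_square)
  have "\<iota> ((\<alpha> - \<alpha> ^ q) / \<gamma>2) + \<iota> w * \<iota> (1 / \<gamma>2) = \<iota> ((\<alpha> - \<alpha> ^ q + w) / \<gamma>2)"
    by (simp add: add_divide_distrib)
  also have "(\<alpha> - \<alpha> ^ q + w) / \<gamma>2 = u"
    using assms(1,2) by simp
  finally have w: "\<iota> ((\<alpha> - \<alpha> ^ q) / \<gamma>2) + \<iota> w * \<iota> (1 / \<gamma>2) = \<iota> u" .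
  have "C1tw * (\<Upsilon>2 + \<iota> w * \<Upsilon>1) = (x - \<iota> (\<alpha> ^ q)) ^ 2 + \<iota> w * (x - \<iota> (\<alpha> ^ q)) +
      C1tw * (\<iota> ((\<alpha> - \<alpha> ^ q) / \<gamma>2) + \<iota> w * \<iota> (1 / \<gamma>2))"
  proof -
    have "c * (X ^ 2 / c + p + w' * (X / c + r)) = X ^ 2 + w' * X + c * (p + w' * r)"
      if "c \<noteq> 0" for c X p w' r :: 'k
      using that by (simp add: field_simps)
    then show ?thesis
      unfolding \<Upsilon>1 \<Upsilon>2 using C1tw_nonzero by blast
  qed
  also have "\<dots> = (x - \<iota> \<alpha>) * T2"
    unfolding w unfolding T2_stable \<delta>_eq assms(2) by (simp add: algebra_simps power2_eq_square)
  finally show ?thesis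
    using x_minus_nonzero(1)[of \<alpha>] by (simp add: field_simps)
qed

end

lemma inverse_h_mem: "1 / h \<in> inverse_ideal E \<iota> x y (Affine \<alpha> \<beta>)"
proof -
  have "(x - \<iota> \<alpha>) * (1 / h) = y - \<iota> \<beta>' - \<iota> \<kappa> * (x - \<iota> \<alpha>)"
    using x_minus_nonzero(1)[of \<alpha>] by (simp add: inverse_h)
  moreover have "(y - \<iota> \<beta>) * (1 / h) = W - \<iota> \<kappa> * (y - \<iota> \<beta>)"
  proof -
    have "(y - \<iota> \<beta>) * (y - \<iota> \<beta>' - \<iota> \<kappa> * (x - \<iota> \<alpha>)) = (x - \<iota> \<alpha>) * (W - \<iota> \<kappa> * (y - \<iota> \<beta>))"
      using W_eq by algebra
    then show ?thesis
      using x_minus_nonzero(1)[of \<alpha>] unfolding inverse_h by (simp add: field_simps)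
  qed
  moreover have "1 / h \<in> K"
    by (intro func_field_closed func_field_mem ring_mem h_mem)
  moreover have "y - \<iota> \<beta>' - \<iota> \<kappa> * (x - \<iota> \<alpha>) \<in> A" "W - \<iota> \<kappa> * (y - \<iota> \<beta>) \<in> A"
    by (intro ring_closed ring_mem W_mem)+
  ultimately show ?thesis
    unfolding inverse_ideal_iff[OF V] by metis
qed

text \<open>Necessity is read off from the two coordinates of \<open>\<tau> E\<^sub>2\<close>. For sufficiency, \<open>\<tau> E\<^sub>1\<close> lies in \<open>M\<close> because the
pole of \<open>1 / h\<close> at \<open>V\<close> is simple, and the images of the multiples of \<open>E\<^sub>2\<close> are covered by \<open>stable_E2\<close>.\<close>

lemma stable_iff:
  assumes M: "M = A \<times> inverse_ideal E \<iota> x y (Affine \<alpha> \<beta>)"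
    and \<tau>: "twist_semilinear q \<iota> x y \<tau>"
    and \<tau>E1: "\<tau> (1, 0) = scale (1 / \<iota> lam1) (- (x + \<iota> \<gamma>1), 1 / h)"
    and \<tau>E2: "\<tau> (0, 1) = scale (1 / \<iota> lam1) (T1, T2)"
  shows "\<tau> ` M \<subseteq> M \<longleftrightarrow>
    lam1 ^ (q + 1) = u * \<gamma>1 - v \<and> lam1 ^ q * lam2 = - (\<chi>1 ^ q) - \<gamma>1 ^ q - \<gamma>1"
proof
  assume stable: "\<tau> ` M \<subseteq> M"
  have mem_M: "(a, b) \<in> M \<longleftrightarrow> a \<in> A \<and> b \<in> inverse_ideal E \<iota> x y (Affine \<alpha> \<beta>)" for a b
    by (simp add: M)
  have "(0, 1) \<in> M"
    unfolding mem_M inverse_ideal_iff[OF V] by (simp add: func_field_mem ring_closed)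
  then have "(1 / \<iota> lam1 * T1, 1 / \<iota> lam1 * T2) \<in> M"
    using stable \<tau>E2 by (auto simp: scale_def)
  then have "1 / \<iota> lam1 * T1 \<in> A" "(x - \<iota> \<alpha>) * (1 / \<iota> lam1 * T2) \<in> A"
    unfolding mem_M inverse_ideal_iff[OF V] by auto
  from this[THEN ring_closed(3)[OF ring_mem(4)[of lam1]]]
  have "T1 \<in> A" "(x - \<iota> \<alpha>) * T2 \<in> A"
    using lam1 by simp_all
  then show "lam1 ^ (q + 1) = u * \<gamma>1 - v \<and> lam1 ^ q * lam2 = - (\<chi>1 ^ q) - \<gamma>1 ^ q - \<gamma>1"
    using systems_equivalent unfolding T1_mem_iff T2_mem_iff by blast
next
  assume C: "lam1 ^ (q + 1) = u * \<gamma>1 - v \<and> lam1 ^ q * lam2 = - (\<chi>1 ^ q) - \<gamma>1 ^ q - \<gamma>1"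
  show "\<tau> ` M \<subseteq> M"
  proof
    fix z
    assume "z \<in> \<tau> ` M"
    then obtain f g where fg: "f \<in> A" "g \<in> inverse_ideal E \<iota> x y (Affine \<alpha> \<beta>)" "z = \<tau> (f, g)"
      unfolding M by auto
    have K: "f \<in> K" "g \<in> K" "0 \<in> K" "1 \<in> K"
      using fg(1,2) unfolding inverse_ideal_iff[OF V] by auto
    have "\<tau> (f, g) = \<tau> (scale f (1, 0) + scale g (0, 1))"
      by (simp add: scale_def)
    also have "\<dots> = \<tau> (scale f (1, 0)) + \<tau> (scale g (0, 1))"
    proof -
      have "scale f (1, 0) \<in> K \<times> K" "scale g (0, 1) \<in> K \<times> K"
        using K by (simp_all add: scale_def)
      moreover have "\<forall>v\<in>K \<times> K. \<forall>w\<in>K \<times> K. \<tau> (v + w) = \<tau> v + \<tau> w"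
        using \<tau> unfolding twist_semilinear_def Let_def by (rule conjunct1)
      ultimately show ?thesis
        by (metis (no_types))
    qed
    also have "\<dots> = scale (tw f) (\<tau> (1, 0)) + scale (tw g) (\<tau> (0, 1))"
      using \<tau> K unfolding twist_semilinear_def Let_def by auto
    finally have z: "z = (\<iota> (1 / lam1) * (tw f * - (x + \<iota> \<gamma>1) + tw g * T1),
        \<iota> (1 / lam1) * (tw f * (1 / h) + tw g * T2))"
      unfolding fg(3) \<tau>E1 \<tau>E2 by (simp add: scale_def algebra_simps)
    note stable = stable_E2[OF conjunct1[OF C] conjunct2[OF C] fg(2)]
    have "tw f * - (x + \<iota> \<gamma>1) + tw g * T1 \<in> A"
      by (rule ring_closed(1)[OF ring_closed(3)[OF twist_ring[OF fg(1)]] stable(1)])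
        (intro ring_minus ring_closed ring_mem)
    moreover have "tw f * (1 / h) + tw g * T2 \<in> inverse_ideal E \<iota> x y (Affine \<alpha> \<beta>)"
      by (rule inverse_ideal_add[OF V inverse_ideal_module[OF V inverse_h_mem twist_ring[OF fg(1)]]
        stable(2)])
    ultimately show "z \<in> M"
      unfolding z M
      by (rule SigmaI[OF ring_closed(3)[OF ring_mem(4)] inverse_ideal_module[OF V _ ring_mem(4)]])
  qed
qed

end

theorem theorem3p19:
  fixes p n q :: nat
    and E :: "'l::alg_closed_field weierstrass"
    and \<theta> \<eta> \<alpha> \<beta> \<beta>' \<kappa> lam1 lam2 m \<gamma>1 \<gamma>2 \<chi>1 \<chi>2 u v w :: 'l
    and V :: "'l point"
    and \<iota> :: "'l \<Rightarrow> 'k::field"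
    and x y h C2 C1' \<Upsilon>1 \<Upsilon>2 T1 T2 :: 'k
    and tw :: "'k \<Rightarrow> 'k"
    and M :: "('k \<times> 'k) set"
    and \<tau> :: "'k \<times> 'k \<Rightarrow> 'k \<times> 'k"
  assumes q: "prime p" "n > 0" "q = p ^ n" "CHAR('l) = p"
    and E: "nonsingular E" "defined_over_Fq q E"
    and xi: "generic_point q E \<theta> \<eta>"
    and xy: "coordinates E \<iota> x y"
    and tw: "tw = twist q \<iota> x y"
    and V: "V = Affine \<alpha> \<beta>" "V \<in> curve_points E"
           "padd E V (pneg E (frob_point q V)) = Affine \<theta> \<eta>"
    and lam1: "lam1 \<noteq> 0"
    and \<beta>': "\<beta>' = - \<beta> - a1 E * \<alpha> - a3 E"
    and m: "m = (\<beta> ^ q - \<beta>') / (\<alpha> ^ q - \<alpha>)"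
    and \<gamma>1: "\<gamma>1 = (\<kappa> ^ q + m + a1 E) * (m - \<kappa>) - \<theta>"
    and \<gamma>2: "\<gamma>2 = - (\<kappa> ^ q) - m - a1 E"
    and \<chi>1: "\<chi>1 = \<kappa> ^ 2 + a1 E * \<kappa> - a2 E - \<alpha>"
    and \<chi>2: "\<chi>2 = a4 E - 2 * \<kappa> * \<beta>' + \<kappa> ^ 2 * \<alpha> - a1 E * \<beta>' - a3 E * \<kappa> + a2 E * \<alpha> + \<alpha> ^ 2"
    and u: "u = \<kappa> ^ q - \<kappa>"
    and v: "v = \<beta>' ^ q - \<beta>' - \<kappa> ^ q * \<alpha> ^ q + \<kappa> * \<alpha>"
    and w: "w = u * \<gamma>2 + \<alpha> ^ q - \<alpha>"
    and h: "h = (x - \<iota> \<alpha>) / (y - \<iota> \<beta>' - \<iota> \<kappa> * (x - \<iota> \<alpha>))"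
    and C2: "C2 = x ^ 2 - \<iota> \<chi>1 * x + \<iota> \<chi>2"
    and C1': "C1' = y + \<iota> (\<kappa> + a1 E) * (x - \<iota> \<alpha>) - \<iota> \<beta>"
    and \<Upsilon>1: "\<Upsilon>1 = (x - \<iota> (\<alpha> ^ q)) / tw C1'
               - \<iota> ((\<alpha> - \<alpha> ^ q) / value_at \<iota> x y (Affine \<alpha> \<beta>') (tw C1'))"
    and \<Upsilon>2: "\<Upsilon>2 = (x - \<iota> (\<alpha> ^ q)) ^ 2 / tw C1'
               - \<iota> ((\<alpha> - \<alpha> ^ q) ^ 2 / value_at \<iota> x y (Affine \<alpha> \<beta>') (tw C1'))"
    and T1: "T1 = tw h * \<iota> (lam1 ^ (q + 1) * \<gamma>2)
               - tw h * (x + \<iota> (lam1 ^ q * lam2 + \<gamma>1 ^ q)) * (x + \<iota> \<gamma>1)"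
    and T2: "T2 = tw h * \<iota> (lam1 ^ (q + 1))
               + tw h * (x + \<iota> (lam1 ^ q * lam2 + \<gamma>1 ^ q)) * (1 / h)"
    and M: "M = coord_ring \<iota> x y \<times> inverse_ideal E \<iota> x y V"
    and \<tau>: "twist_semilinear q \<iota> x y \<tau>"
    and \<tau>E1: "\<tau> (1, 0) = scale (1 / \<iota> lam1) (- (x + \<iota> \<gamma>1), 1 / h)"
    and \<tau>E2: "\<tau> (0, 1) = scale (1 / \<iota> lam1) (T1, T2)"
  shows
    "((- (\<chi>1 ^ q) = lam1 ^ q * lam2 + \<gamma>1 ^ q + \<gamma>1 \<and>
       \<chi>2 ^ q = (lam1 ^ q * lam2 + \<gamma>1 ^ q) * \<gamma>1 - lam1 ^ (q + 1) * \<gamma>2 \<and>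
       - (u * \<chi>1 ^ q) = lam1 ^ (q + 1) + u * (lam1 ^ q * lam2 + \<gamma>1 ^ q) + v \<and>
       u * \<chi>2 ^ q = (lam1 ^ q * lam2 + \<gamma>1 ^ q) * v - lam1 ^ (q + 1) * \<alpha>)
      \<longleftrightarrow>
      (lam1 ^ (q + 1) = u * \<gamma>1 - v \<and>
       lam1 ^ q * lam2 = - (\<chi>1 ^ q) - \<gamma>1 ^ q - \<gamma>1))
     \<and>
     (\<tau> ` M \<subseteq> M \<longleftrightarrow>
      (lam1 ^ (q + 1) = u * \<gamma>1 - v \<and>
       lam1 ^ q * lam2 = - (\<chi>1 ^ q) - \<gamma>1 ^ q - \<gamma>1))
     \<and>
     (lam1 ^ (q + 1) = u * \<gamma>1 - v \<and>
      lam1 ^ q * lam2 = - (\<chi>1 ^ q) - \<gamma>1 ^ q - \<gamma>1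
      \<longrightarrow>
      T1 = - (tw h * tw C2) \<and> - (tw h * tw C2) = - tw C1' \<and>
      (\<gamma>2 \<noteq> 0 \<longrightarrow>
         T2 = T1 / (\<iota> \<alpha> - x) * (\<Upsilon>2 + \<iota> w * \<Upsilon>1) \<and>
         T1 / (\<iota> \<alpha> - x) * (\<Upsilon>2 + \<iota> w * \<Upsilon>1)
           = tw C1' / (x - \<iota> \<alpha>) * (\<Upsilon>2 + \<iota> w * \<Upsilon>1)))"
proof -
  have on: "on_curve E \<alpha> \<beta>"
    using V(1,2) by (auto simp: curve_points_def)
  have "ring_map (\<lambda>c::'l. c ^ q)"
    using q by (intro frobenius_ring_map) simp_all
  then interpret frobenius_curve E \<iota> x y q
    using xy E by (intro frobenius_curve.intro smooth_curve.intro curve_coordinates.intro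
      smooth_curve_axioms.intro frobenius_curve_axioms.intro)
  have "q > 1"
    using q by (metis one_less_power prime_gt_1_nat)
  have moves: "\<alpha> ^ q \<noteq> \<alpha>"
    using frob_moves_point[OF xi \<open>q > 1\<close> on] V(1,3) by simp
  have slope: "\<beta> ^ q - \<beta>' = m * (\<alpha> ^ q - \<alpha>)"
    using moves by (simp add: m)
  have \<theta>: "\<theta> = m ^ 2 + a1 E * m - a2 E - \<alpha> - \<alpha> ^ q"
    using theta_eq[OF moves] V(1,3) slope by (simp add: \<beta>')
  note M_eq = M[unfolded V(1)]
  interpret tau_action E \<iota> x y q \<alpha> \<beta> \<beta>' \<kappa> lam1 lam2 m \<theta> \<gamma>1 \<gamma>2 \<chi>1 \<chi>2 u v h T1 T2
    by unfold_locales
      (fact on moves lam1 \<beta>' slope \<theta> \<gamma>1 \<gamma>2 \<chi>1 \<chi>2 u v h T1[unfolded tw] T2[unfolded tw])+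
  have twC1: "tw C1' = C1tw"
    unfolding tw C1' C1tw_def
    by (simp add: twist_closed func_field_closed func_field_mem ring_closed frob_fixes)
  have twC2: "tw C2 = of_x C2tw"
    unfolding tw C2 C2tw_def power2_eq_square
    by (simp add: twist_closed func_field_closed func_field_mem ring_closed algebra_simps)
  have tw_h_C2: "tw h * tw C2 = tw C1'"
    unfolding twC1 twC2 unfolding tw tw_h using C2tw_nonzero by simp
  show ?thesis
  proof (intro conjI impI)
    assume C: "lam1 ^ (q + 1) = u * \<gamma>1 - v \<and> lam1 ^ q * lam2 = - (\<chi>1 ^ q) - \<gamma>1 ^ q - \<gamma>1"
    note T1 = T1_stable[OF conjunct1[OF C] conjunct2[OF C], folded twC1]
    show "T1 = - (tw h * tw C2)" "- (tw h * tw C2) = - tw C1'"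
      by (simp_all only: tw_h_C2 T1)
    have sign: "T1 / (\<iota> \<alpha> - x) = tw C1' / (x - \<iota> \<alpha>)"
      unfolding T1 by (metis minus_diff_eq minus_divide_divide)
    then show "T1 / (\<iota> \<alpha> - x) * (\<Upsilon>2 + \<iota> w * \<Upsilon>1) = tw C1' / (x - \<iota> \<alpha>) * (\<Upsilon>2 + \<iota> w * \<Upsilon>1)"
      by (simp only:)
    assume "\<gamma>2 \<noteq> 0"
    from T2_residue_formula[OF conjunct1[OF C] conjunct2[OF C] this w
        \<Upsilon>1[unfolded twC1] \<Upsilon>2[unfolded twC1]]
    show "T2 = T1 / (\<iota> \<alpha> - x) * (\<Upsilon>2 + \<iota> w * \<Upsilon>1)"
      unfolding sign twC1 .
  qed (fact systems_equivalent stable_iff[OF M_eq \<tau> \<tau>E1 \<tau>E2])+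
qed

end
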